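(* Let $T\in(\mathbb{C}^3)^*\otimes S_{(2,1)}(\mathbb{C}^3)^*\otimes S_{(2,2)}\mathbb{C}^3\cong\mathbb{C}^3\otimes\mathbb{C}^8\otimes\mathbb{C}^6$ be the nonzero $GL_3$-invariant tensor, which is unique up to scale. Then the border rank of $T$ is $10$, which is the maximal border rank of tensors in $\mathbb{C}^3\otimes\mathbb{C}^8\otimes\mathbb{C}^6$.
   Context: $S_\lambda\mathbb{C}^3$ denotes the irreducible polynomial $GL_3$-module indexed by the partition $\lambda$. We have $\dim S_{(2,1)}\mathbb{C}^3=8$ and $\dim S_{(2,2)}\mathbb{C}^3=6$. The border rank $\underline{R}(T)$ is the smallest $r$ such that $T$ is a limit of tensors that are sums of $r$ rank-one tensors $a\otimes b\otimes c$. *)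

theory Defs
  imports "HOL-Analysis.Analysis" "HOL-Library.Numeral_Type"
begin

definition border_rank_le :: "nat \<Rightarrow> ('a::finite \<Rightarrow> 'b::finite \<Rightarrow> 'c::finite \<Rightarrow> complex) \<Rightarrow> bool" where
  "border_rank_le r T \<longleftrightarrow>
     (\<exists>(A :: nat \<Rightarrow> nat \<Rightarrow> 'a \<Rightarrow> complex) (B :: nat \<Rightarrow> nat \<Rightarrow> 'b \<Rightarrow> complex)
        (C :: nat \<Rightarrow> nat \<Rightarrow> 'c \<Rightarrow> complex).
        \<forall>i j k. (\<lambda>n. \<Sum>l<r. A n l i * B n l j * C n l k) \<longlonglongrightarrow> T i j k)"

definition border_rank :: "('a::finite \<Rightarrow> 'b::finite \<Rightarrow> 'c::finite \<Rightarrow> complex) \<Rightarrow> nat" where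
  "border_rank T = (LEAST r. border_rank_le r T)"

text \<open>Schur modules realised as images of Young symmetrizers c = a o b
  (b = column antisymmetrizer, a = row symmetrizer) acting on tensor powers
  by permutation of tensor positions.
  (2,1): tableau [1 2 / 3], rows {1,2}, columns {1,3}.
  (2,2): tableau [1 2 / 3 4], rows {1,2},{3,4}, columns {1,3},{2,4}.\<close>

definition young21 :: "('i \<times> 'i \<times> 'i \<Rightarrow> complex) \<Rightarrow> ('i \<times> 'i \<times> 'i \<Rightarrow> complex)" where
  "young21 x = (\<lambda>(a,b,c). x (a,b,c) + x (b,a,c) - x (c,b,a) - x (c,a,b))"

definition col22 :: "('i \<times> 'i \<times> 'i \<times> 'i \<Rightarrow> complex) \<Rightarrow> ('i \<times> 'i \<times> 'i \<times> 'i \<Rightarrow> complex)" where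
  "col22 x = (\<lambda>(a,b,c,d). x (a,b,c,d) - x (c,b,a,d) - x (a,d,c,b) + x (c,d,a,b))"

definition row22 :: "('i \<times> 'i \<times> 'i \<times> 'i \<Rightarrow> complex) \<Rightarrow> ('i \<times> 'i \<times> 'i \<times> 'i \<Rightarrow> complex)" where
  "row22 y = (\<lambda>(a,b,c,d). y (a,b,c,d) + y (b,a,c,d) + y (a,b,d,c) + y (b,a,d,c))"

definition young22 :: "('i \<times> 'i \<times> 'i \<times> 'i \<Rightarrow> complex) \<Rightarrow> ('i \<times> 'i \<times> 'i \<times> 'i \<Rightarrow> complex)" where
  "young22 x = row22 (col22 x)"

text \<open>The ambient space (C^3)* (x) ((C^3)* )^{(x)3} (x) (C^3)^{(x)4}, with coordinates
  indexed by 3, 3*3*3 and 3*3*3*3.\<close>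

type_synonym amb_tensor = "3 \<Rightarrow> 3 \<times> 3 \<times> 3 \<Rightarrow> 3 \<times> 3 \<times> 3 \<times> 3 \<Rightarrow> complex"

text \<open>T lies in (C^3)* (x) S_(2,1)((C^3)* ) (x) S_(2,2)(C^3), where S_(2,1)((C^3)* ) is
  isomorphic to (S_(2,1) C^3)*.  The image of id (x) c21 (x) c22 is the tensor
  product of the images.\<close>

definition in_schur_space :: "amb_tensor \<Rightarrow> bool" where
  "in_schur_space T \<longleftrightarrow>
     (\<exists>S :: amb_tensor. T = (\<lambda>i j k. young22 (\<lambda>k'. young21 (\<lambda>j'. S i j' k') j) k))"

definition coef3 :: "complex^3^3 \<Rightarrow> 3 \<times> 3 \<times> 3 \<Rightarrow> 3 \<times> 3 \<times> 3 \<Rightarrow> complex" where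
  "coef3 M = (\<lambda>(a,b,c) (a',b',c'). M$a$a' * M$b$b' * M$c$c')"

definition coef4 :: "complex^3^3 \<Rightarrow> 3 \<times> 3 \<times> 3 \<times> 3 \<Rightarrow> 3 \<times> 3 \<times> 3 \<times> 3 \<Rightarrow> complex" where
  "coef4 M = (\<lambda>(a,b,c,d) (a',b',c',d'). M$a$a' * M$b$b' * M$c$c' * M$d$d')"

text \<open>Action of g in GL_3(C): g acts on C^3 by v |-> g v and on the dual (C^3)* by
  phi |-> phi o g^{-1}, extended to tensor products.\<close>

definition gl3_act :: "complex^3^3 \<Rightarrow> amb_tensor \<Rightarrow> amb_tensor" where
  "gl3_act g T = (\<lambda>i j k. let h = matrix_inv g in
      \<Sum>i'\<in>UNIV. \<Sum>j'\<in>UNIV. \<Sum>k'\<in>UNIV.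
        h$i'$i * coef3 h j' j * coef4 g k k' * T i' j' k')"

definition gl3_invariant :: "amb_tensor \<Rightarrow> bool" where
  "gl3_invariant T \<longleftrightarrow> (\<forall>g :: complex^3^3. invertible g \<longrightarrow> gl3_act g T = T)"

end

theory Submission
  imports Defs "HOL-Computational_Algebra.Polynomial"
begin

text \<open>
  Lower bound: if T is a sum of nine tensors a_l (x) b_l (x) c_l, a dimension count gives a nonzero s
  in the symmetric square of the first factor tensored with the dual of the second, such that the
  contraction of s with T is symmetric in its three indices from the first factor. For the invariant
  tensor only s = 0 has this property, and this is an open condition: up to duality and a power of the
  determinant the tensor describes the kernel of W (x) Sym^2 W \<rightarrow> Sym^3 W, and polarization
  Sym^3 W (x) Sym^2 W \<rightarrow> Sym^2 W (x) Sym^3 W is injective.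

  Upper bound: by Terracini's lemma it suffices that at one explicit point the tangent spaces to the Segre
  variety at ten points span the 144-dimensional space, because a dominant polynomial map has dense image.

  Uniqueness: the Lie algebra relations obtained by differentiating the invariance determine all
  coordinates from the one at the highest weight.
\<close>

section \<open>Linear systems and polynomial functions\<close>

text \<open>The lower bound is a Young flattening. Let A, B, C be the factors of dimension 3, 8, 6.
  A tensor induces a map from Sym^2 A \<otimes> dual(B) to S_(2,1) A \<otimes> C, two spaces of
  dimension 48, and s lies in its kernel exactly when the contraction is symmetric. For a rank-one
  tensor with first factor a the map has rank at most 5, since multiples of a^2 are killed, and 9 *
  5 = 45 < 48. The Koszul flattening into \<Lambda>^2 A \<otimes> C is too small to exclude nine: it
  has rank at most 18, and each summand contributes up to 2.

  For the upper bound, a tangent space of the Segre variety has dimension 3 + 8 + 6 - 2 = 15. Nine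
  of them span at most 135 of 144 dimensions, while ten offer 150, a slack of only 6.

  The invariant tensor is given in the ambient format 3 x 27 x 81. Selecting 8 and 6 coordinates and
  rebuilding the others from them are both linear, so neither raises the border rank, and the value
  is the same as in format 3 x 8 x 6.\<close>

text \<open>Gaussian elimination: a pivot \<open>p\<close> with \<open>A p e\<close> nonzero removes
  the equation \<open>e\<close> together with one unknown, so the surplus of unknowns survives the
  induction.\<close>

lemma underdetermined_system:
  fixes A :: "'m \<Rightarrow> 'e \<Rightarrow> 'f::field"
  assumes "finite E" "finite M" "card E < card M"
  shows "\<exists>c. (\<exists>m\<in>M. c m \<noteq> 0) \<and> (\<forall>e\<in>E. (\<Sum>m\<in>M. c m * A m e) = 0)"
  using assms
proof (induction E arbitrary: M A rule: finite_induct)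
  case empty
  then obtain m where "m \<in> M" by fastforce
  then show ?case by (intro exI[of _ "\<lambda>_. 1"]) auto
next
  case (insert e E)
  show ?case
  proof (cases "\<forall>m\<in>M. A m e = 0")
    case True
    have "card E < card M" using insert by auto
    then obtain c where c: "\<exists>m\<in>M. c m \<noteq> 0" "\<forall>e\<in>E. (\<Sum>m\<in>M. c m * A m e) = 0"
      using insert.IH[OF insert.prems(1), of A] by auto
    then show ?thesis using True by (intro exI[of _ c]) auto
  next
    case False
    then obtain p where p: "p \<in> M" "A p e \<noteq> 0" by auto
    define A' where "A' m e' = A m e' - A m e / A p e * A p e'" for m e'
    have "card E < card (M - {p})" using insert p by auto
    then obtain c where c: "\<exists>m\<in>M - {p}. c m \<noteq> 0"
      "\<forall>e\<in>E. (\<Sum>m\<in>M - {p}. c m * A' m e) = 0"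
      using insert.IH[of "M - {p}" A'] insert.prems by auto
    define d where "d m = (if m = p then - (\<Sum>m\<in>M - {p}. c m * A m e) / A p e else c m)" for m
    have d_sum: "(\<Sum>m\<in>M. d m * A m e') = (\<Sum>m\<in>M - {p}. c m * A' m e')" for e'
    proof -
      have "(\<Sum>m\<in>M. d m * A m e') = d p * A p e' + (\<Sum>m\<in>M - {p}. d m * A m e')"
        using p insert.prems by (subst sum.remove[of _ p]) auto
      also have "(\<Sum>m\<in>M - {p}. d m * A m e') = (\<Sum>m\<in>M - {p}. c m * A m e')"
        by (intro sum.cong) (auto simp: d_def)
      also have "d p * A p e' = - (\<Sum>m\<in>M - {p}. c m * (A m e / A p e * A p e'))"
      proof -
        have "(\<Sum>m\<in>M - {p}. c m * (A m e / A p e * A p e'))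
            = (\<Sum>m\<in>M - {p}. c m * A m e) * (A p e' / A p e)"
          unfolding sum_distrib_right by (intro sum.cong) auto
        then show ?thesis by (simp add: d_def)
      qed
      finally show ?thesis by (simp add: A'_def algebra_simps sum_subtractf)
    qed
    have "(\<Sum>m\<in>M. d m * A m e') = 0" if "e' \<in> insert e E" for e'
      unfolding d_sum using that c(2) p(2) by (auto simp: A'_def)
    moreover have "\<exists>m\<in>M. d m \<noteq> 0" using c(1) by (auto simp: d_def)
    ultimately show ?thesis by blast
  qed
qed

section \<open>Polynomial functions with bounded partial degrees\<close>

definition monomial_fun :: "('n::finite \<Rightarrow> nat) \<Rightarrow> complex^'n \<Rightarrow> complex" where
  "monomial_fun e x = (\<Prod>i\<in>UNIV. x$i ^ e i)"

definition exponents :: "nat \<Rightarrow> ('n::finite \<Rightarrow> nat) set" where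
  "exponents K = {e. \<forall>i. e i \<le> K}"

text \<open>The degree is bounded in each variable separately, which makes counting monomials easy.\<close>

inductive poly_fun :: "nat \<Rightarrow> (complex^'n::finite \<Rightarrow> complex) \<Rightarrow> bool" for K where
  zero: "poly_fun K (\<lambda>x. 0)"
| add_monomial: "\<lbrakk>poly_fun K f; e \<in> exponents K\<rbrakk> \<Longrightarrow> poly_fun K (\<lambda>x. f x + c * monomial_fun e x)"

lemma exponents_eq_PiE: "exponents K = PiE (UNIV :: 'n::finite set) (\<lambda>_. {..K})"
  by (auto simp: exponents_def PiE_def Pi_def)

lemma finite_exponents [simp]: "finite (exponents K :: ('n::finite \<Rightarrow> nat) set)"
  by (simp add: exponents_eq_PiE finite_PiE)

lemma card_exponents: "card (exponents K :: ('n::finite \<Rightarrow> nat) set) = (K + 1) ^ CARD('n)"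
  by (simp add: exponents_eq_PiE card_PiE)

lemma poly_fun_sum_monomials:
  assumes "poly_fun K f"
  shows "\<exists>A. \<forall>x. f x = (\<Sum>e\<in>exponents K. A e * monomial_fun e x)"
  using assms
proof induction
  case zero
  then show ?case by (intro exI[of _ "\<lambda>_. 0"]) simp
next
  case (add_monomial f e c)
  then obtain A where A: "\<And>x. f x = (\<Sum>e\<in>exponents K. A e * monomial_fun e x)" by blast
  have "f x + c * monomial_fun e x
      = (\<Sum>e'\<in>exponents K. (A e' + (if e' = e then c else 0)) * monomial_fun e' x)" for x
    using add_monomial.hyps(2) by (simp add: A distrib_right sum.distrib if_distrib[of "\<lambda>t. t * _"] sum.delta cong: if_cong)
  then show ?case by (intro exI[of _ "\<lambda>e'. A e' + (if e' = e then c else 0)"]) blast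
qed

lemma poly_fun_scaled_monomial: "e \<in> exponents K \<Longrightarrow> poly_fun K (\<lambda>x. c * monomial_fun e x)"
  using poly_fun.add_monomial[OF poly_fun.zero, of e K c] by simp

lemma poly_fun_add: "\<lbrakk>poly_fun K f; poly_fun K g\<rbrakk> \<Longrightarrow> poly_fun K (\<lambda>x. f x + g x)"
proof (rotate_tac, induction rule: poly_fun.induct)
  case (add_monomial g e c)
  then show ?case using poly_fun.add_monomial[of K "\<lambda>x. f x + g x" e c] by (simp add: add.assoc)
qed auto

lemma poly_fun_sum: "(\<And>i. i \<in> I \<Longrightarrow> poly_fun K (f i)) \<Longrightarrow> poly_fun K (\<lambda>x. \<Sum>i\<in>I. f i x)"
  by (induction I rule: infinite_finite_induct) (auto intro: poly_fun.zero poly_fun_add)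

lemma poly_fun_mono: "\<lbrakk>poly_fun K f; K \<le> L\<rbrakk> \<Longrightarrow> poly_fun L f"
proof (induction rule: poly_fun.induct)
  case (add_monomial f e c)
  then have "e \<in> exponents L" unfolding exponents_def using le_trans by blast
  with add_monomial show ?case by (intro poly_fun.add_monomial) auto
qed (rule poly_fun.zero)

lemma monomial_fun_mult: "monomial_fun d x * monomial_fun e x = monomial_fun (\<lambda>i. d i + e i) x"
  by (simp add: monomial_fun_def power_add prod.distrib)

lemma poly_fun_mult_monomial:
  assumes "poly_fun K f" "e \<in> exponents L"
  shows "poly_fun (K + L) (\<lambda>x. f x * (c * monomial_fun e x))"
  using assms(1)
proof induction
  case (add_monomial f d b)
  have "(\<lambda>i. d i + e i) \<in> exponents (K + L)"
    using add_monomial assms(2) by (auto simp: exponents_def add_mono)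
  from poly_fun.add_monomial[OF add_monomial.IH this, of "b * c"]
  show ?case by (simp add: algebra_simps flip: monomial_fun_mult)
qed (auto intro: poly_fun.zero)

lemma poly_fun_mult:
  assumes "poly_fun K f" "poly_fun L g"
  shows "poly_fun (K + L) (\<lambda>x. f x * g x)"
  using assms(2)
proof induction
  case (add_monomial g e c)
  then show ?case
    using poly_fun_add[OF add_monomial.IH poly_fun_mult_monomial[OF assms(1), of e L c]]
    by (simp add: distrib_left)
qed (auto intro: poly_fun.zero)

lemma poly_fun_const: "poly_fun K (\<lambda>x. c)"
  using poly_fun_scaled_monomial[of "\<lambda>_. 0" K c] by (simp add: exponents_def monomial_fun_def)

lemma poly_fun_cmult: "poly_fun K f \<Longrightarrow> poly_fun K (\<lambda>x. c * f x)"
  using poly_fun_mult[OF poly_fun_const[of 0 c], of K f] by simp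

lemma poly_fun_coordinate: "poly_fun 1 (\<lambda>x. x$i)"
proof -
  have "monomial_fun (\<lambda>j. if j = i then 1 else 0) x = x$i" for x :: "complex^'a"
    by (simp add: monomial_fun_def if_distrib[of "\<lambda>k. _ ^ k"] cong: if_cong)
  then show ?thesis
    using poly_fun_scaled_monomial[of "\<lambda>j. if j = i then 1 else 0" 1 1] by (simp add: exponents_def)
qed

lemma poly_fun_power: "poly_fun K f \<Longrightarrow> poly_fun (n * K) (\<lambda>x. f x ^ n)"
  by (induction n) (auto intro: poly_fun_const dest: poly_fun_mult)

lemma poly_fun_prod:
  "(\<And>i. i \<in> I \<Longrightarrow> poly_fun K (f i)) \<Longrightarrow> poly_fun (card I * K) (\<lambda>x. \<Prod>i\<in>I. f i x)"
proof (induction I rule: infinite_finite_induct)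
  case (insert i I)
  have "poly_fun (K + card I * K) (\<lambda>x. f i x * (\<Prod>i\<in>I. f i x))"
    by (intro poly_fun_mult insert) auto
  then show ?case using insert by simp
qed (auto intro: poly_fun_const)

lemma continuous_on_poly_fun: "poly_fun K f \<Longrightarrow> continuous_on S f"
  by (induction rule: poly_fun.induct)
    (auto intro!: continuous_intros simp: monomial_fun_def)

lemma poly_fun_det:
  assumes "\<And>i j. poly_fun K (\<lambda>x. M x $ i $ j)"
  shows "\<exists>L. poly_fun L (\<lambda>x. det (M x :: complex^'m^'m))"
  unfolding det_def
  by (rule exI[of _ "CARD('m) * K"]) (intro poly_fun_sum poly_fun_cmult poly_fun_prod assms)

text \<open>A polynomial is given by its coefficients because the counting argument delivers a
  nonzero coefficient, not a nonzero value. \<open>poly_of_coeffs_nonzero_on_open\<close> passes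
  from one to the other.\<close>

definition poly_of_coeffs :: "nat \<Rightarrow> (('n::finite \<Rightarrow> nat) \<Rightarrow> complex) \<Rightarrow> complex^'n \<Rightarrow> complex" where
  "poly_of_coeffs N c y = (\<Sum>e\<in>exponents N. c e * monomial_fun e y)"

lemma continuous_on_poly_of_coeffs: "continuous_on S (poly_of_coeffs N c)"
  by (auto intro!: continuous_intros simp: poly_of_coeffs_def[abs_def] monomial_fun_def)

text \<open>For large N there are more products of powers of g and the components of f than monomials
  that can occur in them.\<close>

lemma algebraic_relation:
  fixes f :: "complex^'n::finite \<Rightarrow> complex^'n"
  assumes f: "\<And>i. poly_fun D (\<lambda>x. f x $ i)" and g: "poly_fun D g"
  obtains N c where "\<exists>k\<le>N. \<exists>e\<in>exponents N. c k e \<noteq> 0"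
    "\<And>x. (\<Sum>k\<le>N. poly_of_coeffs N (c k) (f x) * g x ^ k) = 0"
proof -
  define n where "n = CARD('n)"
  \<comment> \<open>There are \<open>(N + 1) ^ (n + 1)\<close> products and
    \<open>(K + 1) ^ n\<close> monomials, and \<open>K + 1\<close> is at most \<open>N + 1\<close>
    times \<open>(n + 1) * D + 1\<close>. The n-th power of the last factor is \<open>N\<close>
    itself, which is smaller than the remaining factor \<open>N + 1\<close> of the number of
    products.\<close>
  define N where "N = ((n + 1) * D + 1) ^ n"
  define K where "K = N * (n + 1) * D"
  define M :: "(nat \<times> ('n \<Rightarrow> nat)) set" where "M = {..N} \<times> exponents N"
  have "poly_fun K (\<lambda>x. monomial_fun (snd m) (f x) * g x ^ fst m)" if m: "m \<in> M" for m
  proof -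
    obtain k e where ke: "m = (k, e)" by force
    have k: "k \<le> N" and e: "\<And>i. e i \<le> N" using m by (auto simp: ke M_def exponents_def)
    have "poly_fun (n * (N * D)) (\<lambda>x. \<Prod>i\<in>UNIV. f x $ i ^ e i)"
      unfolding n_def by (intro poly_fun_prod poly_fun_mono[OF poly_fun_power[OF f]] mult_le_mono1 e)
    then have "poly_fun (n * (N * D) + N * D) (\<lambda>x. (\<Prod>i\<in>UNIV. f x $ i ^ e i) * g x ^ k)"
      by (intro poly_fun_mult poly_fun_mono[OF poly_fun_power[OF g]] mult_le_mono1 k)
    moreover have "n * (N * D) + N * D = K" by (simp add: K_def algebra_simps)
    ultimately show ?thesis by (simp add: ke monomial_fun_def)
  qed
  then have "\<forall>m\<in>M. \<exists>A. \<forall>x. monomial_fun (snd m) (f x) * g x ^ fst m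
      = (\<Sum>e\<in>exponents K. A e * monomial_fun e x)"
    using poly_fun_sum_monomials by blast
  then obtain A where A: "\<And>m x. m \<in> M \<Longrightarrow> monomial_fun (snd m) (f x) * g x ^ fst m
      = (\<Sum>e\<in>exponents K. A m e * monomial_fun e x)"
    by metis
  have "card (exponents K :: ('n \<Rightarrow> nat) set) < card M"
  proof -
    have "K + 1 \<le> (N + 1) * ((n + 1) * D + 1)" by (simp add: K_def algebra_simps)
    then have "(K + 1) ^ n \<le> (N + 1) ^ n * ((n + 1) * D + 1) ^ n"
      by (metis power_mono power_mult_distrib zero_le)
    also have "\<dots> < (N + 1) ^ n * (N + 1)" unfolding N_def by simp
    finally show ?thesis by (simp add: M_def card_exponents card_cartesian_product n_def mult.commute)
  qed
  moreover have "finite M" by (simp add: M_def)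
  ultimately obtain c where c: "\<exists>m\<in>M. c m \<noteq> 0" "\<forall>e\<in>exponents K. (\<Sum>m\<in>M. c m * A m e) = 0"
    using underdetermined_system[OF finite_exponents[of K], of M A] by blast
  show ?thesis
  proof
    show "\<exists>k\<le>N. \<exists>e\<in>exponents N. c (k, e) \<noteq> 0" using c(1) by (auto simp: M_def)
    fix x
    have "(\<Sum>k\<le>N. poly_of_coeffs N (\<lambda>e. c (k, e)) (f x) * g x ^ k)
        = (\<Sum>m\<in>M. c m * (monomial_fun (snd m) (f x) * g x ^ fst m))"
      by (simp add: poly_of_coeffs_def M_def sum_distrib_right sum.cartesian_product
          case_prod_beta mult.assoc)
    also have "\<dots> = (\<Sum>m\<in>M. \<Sum>e\<in>exponents K. c m * A m e * monomial_fun e x)"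
      by (intro sum.cong) (auto simp: A sum_distrib_left mult.assoc)
    also have "\<dots> = (\<Sum>e\<in>exponents K. (\<Sum>m\<in>M. c m * A m e) * monomial_fun e x)"
      by (subst sum.swap) (simp add: sum_distrib_right)
    also have "\<dots> = 0" using c(2) by simp
    finally show "(\<Sum>k\<le>N. poly_of_coeffs N (\<lambda>e. c (k, e)) (f x) * g x ^ k) = 0" .
  qed
qed

section \<open>Nonzero polynomials on open sets\<close>

lemma poly_of_coeffs_line:
  "\<exists>p. \<forall>s. poly_of_coeffs N c (\<chi> i. u$i + s * v$i) = poly p s"
proof (intro exI allI)
  fix s
  show "poly_of_coeffs N c (\<chi> i. u$i + s * v$i)
      = poly (\<Sum>e\<in>exponents N. smult (c e) (\<Prod>i\<in>UNIV. [:u$i, v$i:] ^ e i)) s"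
    by (simp add: poly_of_coeffs_def monomial_fun_def poly_sum poly_prod)
qed

lemma digits_unique:
  fixes d e :: "nat \<Rightarrow> nat"
  assumes "\<And>m. m < n \<Longrightarrow> d m < B" "\<And>m. m < n \<Longrightarrow> e m < B"
    and "(\<Sum>m<n. d m * B ^ m) = (\<Sum>m<n. e m * B ^ m)" "m < n"
  shows "d m = e m"
  using assms
proof (induction n arbitrary: d e m)
  case (Suc n)
  have split: "(\<Sum>m<Suc n. h m * B ^ m) = h 0 + B * (\<Sum>m<n. h (Suc m) * B ^ m)" for h :: "nat \<Rightarrow> nat"
    by (subst sum.lessThan_Suc_shift) (simp add: sum_distrib_left mult_ac)
  have B: "d 0 < B" "e 0 < B" using Suc.prems by auto
  have eq: "d 0 + B * (\<Sum>m<n. d (Suc m) * B ^ m) = e 0 + B * (\<Sum>m<n. e (Suc m) * B ^ m)"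
    using Suc.prems(3) unfolding split .
  then have "(d 0 + B * (\<Sum>m<n. d (Suc m) * B ^ m)) mod B = (e 0 + B * (\<Sum>m<n. e (Suc m) * B ^ m)) mod B"
    by simp
  then have 0: "d 0 = e 0" using B by simp
  then have "(\<Sum>m<n. d (Suc m) * B ^ m) = (\<Sum>m<n. e (Suc m) * B ^ m)" using eq B by simp
  then have "d (Suc k) = e (Suc k)" if "k < n" for k
    by (rule Suc.IH[rotated 2]) (use Suc.prems that in auto)
  then show ?case using 0 Suc.prems(4) by (cases m) auto
qed simp

text \<open>Vanishing near \<open>u\<close> gives infinitely many zeros on every complex line
  through \<open>u\<close>, hence vanishing at every point. Substituting suitable powers of one
  variable then exhibits \<open>c e\<close> as a coefficient of the zero polynomial.\<close>

lemma poly_of_coeffs_nonzero_on_open: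
  fixes U :: "(complex^'n::finite) set"
  assumes "open U" "u \<in> U" "e \<in> exponents N" "c e \<noteq> 0"
  shows "\<exists>y\<in>U. poly_of_coeffs N c y \<noteq> 0"
proof (rule ccontr)
  assume "\<not> ?thesis"
  then have vanish: "\<And>y. y \<in> U \<Longrightarrow> poly_of_coeffs N c y = 0" by blast
  have zero: "poly_of_coeffs N c y = 0" for y
  proof -
    define l where "l s = (\<chi> i. u$i + s * (y - u)$i)" for s
    obtain p where p: "\<And>s. poly_of_coeffs N c (l s) = poly p s"
      using poly_of_coeffs_line[of N c u "y - u"] by (auto simp: l_def)
    have "continuous_on UNIV l" unfolding l_def by (intro continuous_intros)
    moreover have "l 0 = u" by (simp add: l_def)
    ultimately have op: "open (l -` U)" and 0: "0 \<in> l -` U"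
      using assms by (auto simp: open_vimage)
    obtain r where "r > 0" "ball 0 r \<subseteq> l -` U" using op 0 by (meson open_contains_ball)
    then have "infinite (l -` U)" using uncountable_ball[of r 0] countable_finite finite_subset by blast
    moreover have "l -` U \<subseteq> {s. poly p s = 0}" using vanish p by force
    ultimately have "p = 0" using poly_roots_finite finite_subset by blast
    moreover have "l 1 = y" by (simp add: l_def vec_eq_iff)
    ultimately show ?thesis using p[of 1] by simp
  qed
  obtain \<iota> :: "'n \<Rightarrow> nat" where \<iota>: "bij_betw \<iota> UNIV {..<CARD('n)}"
    using finite_same_card_bij[of "UNIV :: 'n set" "{..<CARD('n)}"] by auto
  \<comment> \<open>Kronecker substitution: in base N + 1 distinct exponent vectors have distinct values.\<close>
  define \<kappa> where "\<kappa> e = (\<Sum>i\<in>UNIV. e i * (N + 1) ^ \<iota> i)" for e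
  have inj: "inj_on \<kappa> (exponents N)"
  proof (rule inj_onI)
    fix d e assume de: "d \<in> exponents N" "e \<in> exponents N" "\<kappa> d = \<kappa> e"
    define j where "j = inv_into UNIV \<iota>"
    have j: "j (\<iota> i) = i" for i using \<iota> by (simp add: j_def bij_betw_def)
    have \<kappa>: "\<kappa> h = (\<Sum>m<CARD('n). h (j m) * (N + 1) ^ m)" for h
      unfolding \<kappa>_def by (subst sum.reindex_bij_betw[OF \<iota>, symmetric]) (simp add: j)
    show "d = e"
    proof
      fix i
      have "\<iota> i < CARD('n)" using \<iota> by (auto simp: bij_betw_def)
      from digits_unique[of "CARD('n)" "\<lambda>m. d (j m)" "N + 1" "\<lambda>m. e (j m)", OF _ _ _ this]
      show "d i = e i" using de by (simp add: \<kappa> exponents_def j less_Suc_eq_le)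
    qed
  qed
  define q where "q = (\<Sum>e\<in>exponents N. Polynomial.monom (c e) (\<kappa> e))"
  have "poly q t = poly_of_coeffs N c (\<chi> i. t ^ ((N + 1) ^ \<iota> i))" for t
    unfolding q_def poly_of_coeffs_def monomial_fun_def \<kappa>_def
    by (simp add: poly_sum poly_monom power_sum mult.commute flip: power_mult)
  then have "q = 0" using zero by (auto simp: poly_eq_poly_eq_iff[symmetric])
  then have "coeff q (\<kappa> e) = 0" by simp
  also have "coeff q (\<kappa> e) = (\<Sum>d\<in>exponents N. if d = e then c e else 0)"
    unfolding q_def coeff_sum
    by (intro sum.cong) (use inj assms(3) in \<open>auto simp: inj_on_def\<close>)
  finally show False using assms by simp
qed

section \<open>Dominant polynomial maps\<close>

lemma finitely_many_poly_of_coeffs_nonzero_on_open: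
  fixes U :: "(complex^'n::finite) set"
  assumes "finite I" "open U" "u \<in> U"
    and "\<And>i. i \<in> I \<Longrightarrow> \<exists>e\<in>exponents (N i). c i e \<noteq> 0"
  shows "\<exists>y\<in>U. \<forall>i\<in>I. poly_of_coeffs (N i) (c i) y \<noteq> 0"
  using assms
proof (induction I arbitrary: U u rule: finite_induct)
  case (insert i I)
  obtain e where e: "e \<in> exponents (N i)" "c i e \<noteq> 0" using insert.prems by blast
  obtain y where y: "y \<in> U" "poly_of_coeffs (N i) (c i) y \<noteq> 0"
    using poly_of_coeffs_nonzero_on_open[OF insert.prems(1,2) e(1), of "c i"] e(2) by blast
  let ?V = "U \<inter> poly_of_coeffs (N i) (c i) -` (- {0})"
  have "open ?V"
    using insert.prems(1) by (intro open_Int open_vimage continuous_on_poly_of_coeffs) auto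
  moreover have "y \<in> ?V" using y by simp
  ultimately show ?case using insert.IH[of ?V y] insert.prems(3) by auto
qed auto

text \<open>Cauchy's bound. It is continuous in the coefficients as long as the leading one is
  nonzero, and so keeps the preimages of a convergent sequence bounded.\<close>

lemma root_bound:
  fixes a :: "nat \<Rightarrow> complex"
  assumes "a K \<noteq> 0" "(\<Sum>k\<le>K. a k * z ^ k) = 0"
  shows "norm z \<le> 1 + (\<Sum>k<K. norm (a k)) / norm (a K)"
proof (cases "norm z \<le> 1")
  case True
  then show ?thesis by (smt (verit) divide_nonneg_nonneg norm_ge_zero sum_nonneg)
next
  case False
  then have K: "K > 0" using assms by (cases K) auto
  have "a K * z ^ K = - (\<Sum>k<K. a k * z ^ k)"
    using assms(2) by (simp add: lessThan_Suc_atMost[symmetric] eq_neg_iff_add_eq_0 add.commute)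
  then have "norm (a K) * norm z ^ K = norm (\<Sum>k<K. a k * z ^ k)"
    by (metis norm_minus_cancel norm_mult norm_power)
  also have "\<dots> \<le> (\<Sum>k<K. norm (a k) * norm z ^ (K - 1))"
    using False by (intro sum_norm_le) (auto simp: norm_mult norm_power intro!: mult_left_mono power_increasing)
  also have "\<dots> = (\<Sum>k<K. norm (a k)) * norm z ^ (K - 1)" by (simp add: sum_distrib_right)
  finally have "norm (a K) * norm z * norm z ^ (K - 1) \<le> (\<Sum>k<K. norm (a k)) * norm z ^ (K - 1)"
    using K by (simp add: mult.assoc flip: power_Suc)
  then have "norm (a K) * norm z \<le> (\<Sum>k<K. norm (a k))" using False zero_less_power[of "norm z" "K - 1"]
    by (metis mult_le_cancel_right_pos norm_zero zero_less_norm_iff zero_le_one)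
  then have "norm z \<le> (\<Sum>k<K. norm (a k)) / norm (a K)" using assms(1) by (simp add: field_simps)
  then show ?thesis by simp
qed

text \<open>Dropping the top coefficients that are identically zero leaves a nonzero leading one.
  With a coordinate function as \<open>g\<close>, \<open>root_bound\<close> then controls that
  coordinate of all preimages of points where the leading coefficient does not vanish.\<close>

lemma algebraic_relation_leading:
  fixes f :: "complex^'n::finite \<Rightarrow> complex^'n"
  assumes "\<And>i. poly_fun D (\<lambda>x. f x $ i)" "poly_fun D g"
  obtains N K c where "\<exists>e\<in>exponents N. c K e \<noteq> 0"
    "\<And>x. (\<Sum>k\<le>K. poly_of_coeffs N (c k) (f x) * g x ^ k) = 0"
proof -
  obtain N c where c: "\<exists>k\<le>N. \<exists>e\<in>exponents N. c k e \<noteq> 0"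
    "\<And>x. (\<Sum>k\<le>N. poly_of_coeffs N (c k) (f x) * g x ^ k) = 0"
    by (rule algebraic_relation[OF assms]) blast
  define S where "S = {k. k \<le> N \<and> (\<exists>e\<in>exponents N. c k e \<noteq> 0)}"
  have S: "finite S" "S \<noteq> {}" using c(1) by (auto simp: S_def)
  show ?thesis
  proof
    show "\<exists>e\<in>exponents N. c (Max S) e \<noteq> 0" using Max_in[OF S] by (simp add: S_def)
    fix x
    have "poly_of_coeffs N (c k) (f x) * g x ^ k = 0" if "k \<in> {..N} - {..Max S}" for k
    proof -
      have "k \<notin> S" using that Max_ge[OF S(1), of k] by auto
      then show ?thesis using that by (auto simp: S_def poly_of_coeffs_def intro!: sum.neutral)
    qed
    then have "(\<Sum>k\<le>Max S. poly_of_coeffs N (c k) (f x) * g x ^ k)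
        = (\<Sum>k\<le>N. poly_of_coeffs N (c k) (f x) * g x ^ k)"
      using Max_in[OF S] by (intro sum.mono_neutral_left ballI) (auto simp: S_def)
    then show "(\<Sum>k\<le>Max S. poly_of_coeffs N (c k) (f x) * g x ^ k) = 0" by (simp add: c)
  qed
qed

text \<open>Dividing by the lowest power of \<open>g\<close> that occurs makes the constant
  coefficient nonzero; this is why \<open>g x\<close> must not vanish. Applied to the Jacobian
  determinant, the relation shows that the determinant cannot tend to 0 along preimages of points
  whose limit avoids the zeros of that coefficient.\<close>

lemma algebraic_relation_trailing:
  fixes f :: "complex^'n::finite \<Rightarrow> complex^'n"
  assumes "\<And>i. poly_fun D (\<lambda>x. f x $ i)" "poly_fun D g"
  obtains N K c where "\<exists>e\<in>exponents N. c 0 e \<noteq> 0"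
    "\<And>x. g x \<noteq> 0 \<Longrightarrow> (\<Sum>k\<le>K. poly_of_coeffs N (c k) (f x) * g x ^ k) = 0"
proof -
  obtain N c where c: "\<exists>k\<le>N. \<exists>e\<in>exponents N. c k e \<noteq> 0"
    "\<And>x. (\<Sum>k\<le>N. poly_of_coeffs N (c k) (f x) * g x ^ k) = 0"
    by (rule algebraic_relation[OF assms]) blast
  define S where "S = {k. k \<le> N \<and> (\<exists>e\<in>exponents N. c k e \<noteq> 0)}"
  have S: "finite S" "S \<noteq> {}" using c(1) by (auto simp: S_def)
  define m where "m = Min S"
  have m: "m \<in> S" using Min_in[OF S] by (simp add: m_def)
  show ?thesis
  proof
    show "\<exists>e\<in>exponents N. c (0 + m) e \<noteq> 0" using m by (simp add: S_def)
    fix x assume g: "g x \<noteq> 0"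
    have "poly_of_coeffs N (c k) (f x) * g x ^ k = 0" if "k \<in> {..N} - {m..N}" for k
    proof -
      have "k \<notin> S" using that Min_le[OF S(1), of k] by (auto simp: m_def)
      then show ?thesis using that by (auto simp: S_def poly_of_coeffs_def intro!: sum.neutral)
    qed
    then have "(\<Sum>k\<le>N. poly_of_coeffs N (c k) (f x) * g x ^ k)
        = (\<Sum>k=m..N. poly_of_coeffs N (c k) (f x) * g x ^ k)"
      by (intro sum.mono_neutral_right ballI) simp_all
    also have "\<dots> = (\<Sum>k\<le>N-m. poly_of_coeffs N (c (k + m)) (f x) * g x ^ (k + m))"
      using m by (intro sum.reindex_bij_witness[of _ "\<lambda>k. k + m" "\<lambda>k. k - m"]) (auto simp: S_def)
    also have "\<dots> = (\<Sum>k\<le>N-m. poly_of_coeffs N (c (k + m)) (f x) * g x ^ k) * g x ^ m"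
      by (simp add: power_add sum_distrib_right mult.assoc)
    finally show "(\<Sum>k\<le>N-m. poly_of_coeffs N (c (k + m)) (f x) * g x ^ k) = 0"
      using g c(2)[of x] by simp
  qed
qed

lemma
  assumes "invertible A"
  shows matrix_mul_matrix_inv: "A ** matrix_inv A = mat 1"
    and matrix_inv_matrix_mul: "matrix_inv A ** A = mat 1"
  using someI_ex[OF assms[unfolded invertible_def]] by (auto simp: matrix_inv_def)

text \<open>A dominant polynomial map has dense image. Outside a hypersurface of the target, the
  preimages of a point stay bounded and stay away from the critical locus, so that along a complex
  line with finitely many points removed the set of values is open and closed.\<close>

theorem dominant_polynomial_map_dense:
  fixes f :: "complex^'n::finite \<Rightarrow> complex^'n" and df :: "complex^'n \<Rightarrow> complex^'n^'n"
  assumes f: "\<And>i. poly_fun D (\<lambda>x. f x $ i)"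
    and df: "\<And>i j. poly_fun D (\<lambda>x. df x $ i $ j)"
    and deriv: "\<And>x. (f has_derivative (\<lambda>v. df x *v v)) (at x)"
    and x0: "det (df x0) \<noteq> 0"
  shows "closure (range f) = UNIV"
proof -
  define J where "J x = det (df x)" for x
  obtain D0 where D0: "poly_fun D0 J" using poly_fun_det[OF df] by (auto simp: J_def[abs_def])
  define E where "E = max (max D D0) 1"
  have fE: "poly_fun E (\<lambda>x. f x $ i)" and JE: "poly_fun E J" and xE: "poly_fun E (\<lambda>x. x $ i)" for i
    by (auto intro: poly_fun_mono[OF f] poly_fun_mono[OF D0] poly_fun_mono[OF poly_fun_coordinate] simp: E_def)
  have cJ: "continuous_on UNIV J" using JE by (rule continuous_on_poly_fun)
  have cf: "continuous_on UNIV f"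
    using deriv has_derivative_continuous continuous_at_imp_continuous_on by blast
  define R where "R = {x. J x \<noteq> 0}"
  have R: "open R"
  proof -
    have "R = J -` (- {0})" by (auto simp: R_def)
    then show ?thesis using open_vimage[OF open_Compl[OF closed_singleton] cJ] by simp
  qed
  \<comment> \<open>The inverse function theorem at regular points. Below only images of regular
    points are followed along the line, so that the set of values is open.\<close>
  have open_map: "f x \<in> interior (f ` R)" if "x \<in> R" for x
  proof (rule sussmann_open_mapping[OF open_UNIV cf _ deriv])
    have "invertible (df x)" using that by (simp add: R_def J_def invertible_det_nz)
    then show "(\<lambda>v. df x *v v) \<circ> (\<lambda>v. matrix_inv (df x) *v v) = id"
      by (auto simp: fun_eq_iff matrix_vector_mul_assoc matrix_mul_matrix_inv)
    show "bounded_linear (\<lambda>v. matrix_inv (df x) *v v)"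
      by (rule matrix_vector_mul_bounded_linear)
    show "x \<in> interior R" using that R by (simp add: interior_open)
  qed auto
  define rel where "rel i N K c \<longleftrightarrow> (\<exists>e\<in>exponents N. c K e \<noteq> 0) \<and>
    (\<forall>x. (\<Sum>k\<le>K. poly_of_coeffs N (c k) (f x) * (x$i) ^ k) = 0)" for i N K c
  have "\<exists>N K c. rel i N K c" for i
  proof -
    obtain N K c where "\<exists>e\<in>exponents N. c K e \<noteq> 0"
      "\<And>x. (\<Sum>k\<le>K. poly_of_coeffs N (c k) (f x) * (x$i) ^ k) = 0"
      by (rule algebraic_relation_leading[OF fE xE[of i]]) blast
    then have "rel i N K c" by (simp add: rel_def)
    then show ?thesis by blast
  qed
  then obtain N K c where "\<And>i. rel i (N i) (K i) (c i)" by metis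
  then have c: "\<And>i. \<exists>e\<in>exponents (N i). c i (K i) e \<noteq> 0"
    "\<And>i x. (\<Sum>k\<le>K i. poly_of_coeffs (N i) (c i k) (f x) * (x$i) ^ k) = 0"
    by (auto simp: rel_def)
  obtain N' K' c' where c': "\<exists>e\<in>exponents N'. c' 0 e \<noteq> 0"
    "\<And>x. J x \<noteq> 0 \<Longrightarrow> (\<Sum>k\<le>K'. poly_of_coeffs N' (c' k) (f x) * J x ^ k) = 0"
    by (rule algebraic_relation_trailing[OF fE JE]) blast
  \<comment> \<open>The polynomials whose zeros are excluded: \<open>Some i\<close> stands for the
    leading coefficient in the relation of the i-th coordinate, \<open>None\<close> for the constant
    coefficient in the relation of the Jacobian determinant.\<close>
  define lead where "lead i = (case i of None \<Rightarrow> poly_of_coeffs N' (c' 0)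
      | Some i \<Rightarrow> poly_of_coeffs (N i) (c i (K i)))" for i :: "'n option"
  have "\<exists>y\<in>interior (f ` R). \<forall>i\<in>UNIV :: 'n option set. poly_of_coeffs (case i of None \<Rightarrow> N' | Some i \<Rightarrow> N i)
      (case i of None \<Rightarrow> c' 0 | Some i \<Rightarrow> c i (K i)) y \<noteq> 0"
    using open_map[of x0] x0 c(1) c'(1)
    by (intro finitely_many_poly_of_coeffs_nonzero_on_open) (auto simp: R_def J_def split: option.split)
  then obtain y0 where y0': "y0 \<in> interior (f ` R)"
    "\<And>i. poly_of_coeffs (case i of None \<Rightarrow> N' | Some i \<Rightarrow> N i)
      (case i of None \<Rightarrow> c' 0 | Some i \<Rightarrow> c i (K i)) y0 \<noteq> 0"
    by blast
  have y0: "y0 \<in> f ` R" using y0'(1) interior_subset by blast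
  have lead0: "lead i y0 \<noteq> 0" for i using y0'(2)[of i] by (cases i) (auto simp: lead_def)
  have "y \<in> closure (range f)" for y
  proof -
    define l where "l s = (\<chi> i. y0$i + s * (y - y0)$i)" for s
    have cl: "continuous_on A l" for A unfolding l_def by (intro continuous_intros)
    have l01: "l 0 = y0" "l 1 = y" by (simp_all add: l_def vec_eq_iff)
    \<comment> \<open>No excluded hypersurface contains \<open>y0\<close>, so each meets the line in
      finitely many parameters. A plane minus a finite set is connected, which is where complex
      parameters matter.\<close>
    define \<Omega> where "\<Omega> = {s. \<forall>i. lead i (l s) \<noteq> 0}"
    have "\<exists>p. \<forall>s. lead i (l s) = poly p s" for i
      unfolding lead_def l_def by (cases i) (auto simp: poly_of_coeffs_line simp del: vector_minus_component)
    then obtain p where p: "\<And>i s. lead i (l s) = poly (p i) s" by metis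
    have "p i \<noteq> 0" for i using p[of i 0] lead0[of i] by (auto simp: l01)
    then have "finite (\<Union>i. {s. poly (p i) s = 0})" by (simp add: poly_roots_finite)
    moreover have "- \<Omega> = (\<Union>i. {s. poly (p i) s = 0})" by (auto simp: \<Omega>_def p)
    ultimately have fin: "finite (- \<Omega>)" by simp
    have conn: "connected \<Omega>"
      using path_connected_complement_countable[of "- \<Omega>"] countable_finite[OF fin]
      by (simp add: path_connected_imp_connected)
    have lead\<Omega>: "lead i (l s) \<noteq> 0" if "s \<in> \<Omega>" for i s using that by (simp add: \<Omega>_def)
    have open\<Omega>: "open \<Omega>" using finite_imp_closed[OF fin] by (simp add: closed_def)
    define S where "S = \<Omega> \<inter> l -` (f ` R)"
    have S\<Omega>: "S \<subseteq> \<Omega>" by (simp add: S_def)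
    have "openin (top_of_set \<Omega>) S"
    proof -
      have "f ` R = interior (f ` R)" using open_map interior_subset by blast
      then have "open (f ` R)" by (metis open_interior)
      then show ?thesis
        using open\<Omega> cl unfolding S_def by (intro open_openin_trans open_Int open_vimage) auto
    qed
    moreover have "closedin (top_of_set \<Omega>) S"
    proof -
      \<comment> \<open>Regular preimages of the points \<open>l (s n)\<close> are bounded
        coordinate by coordinate, so a subsequence converges to a preimage of \<open>l t\<close>.
        The relation for the Jacobian determinant shows that this limit is again regular.\<close>
      have "t \<in> S" if t: "t \<in> \<Omega>" and tc: "t \<in> closure S" for t
      proof -
        obtain s where s: "\<And>n. s n \<in> S" and lim: "s \<longlonglongrightarrow> t"
          using tc unfolding closure_sequential by blast
        have "\<forall>n. \<exists>x. x \<in> R \<and> f x = l (s n)" using s unfolding S_def by (metis Int_iff imageE vimage_eq)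
        then obtain x where x: "\<And>n. x n \<in> R" "\<And>n. f (x n) = l (s n)" by metis
        have liml: "(\<lambda>n. l (s n)) \<longlonglongrightarrow> l t"
          using continuous_on_tendsto_compose[OF cl[of UNIV] lim] by simp
        have limp: "(\<lambda>n. poly_of_coeffs M d (l (s n))) \<longlonglongrightarrow> poly_of_coeffs M d (l t)" for M d
          using continuous_on_tendsto_compose[OF continuous_on_poly_of_coeffs[of UNIV M d] liml] by simp
        have "\<exists>B. \<forall>n. norm (x n $ i) \<le> B" for i
        proof -
          define q where "q n = poly_of_coeffs (N i) (c i (K i)) (l (s n))" for n
          define r where "r n = (\<Sum>k<K i. norm (poly_of_coeffs (N i) (c i k) (l (s n))))" for n
          have q0: "q n \<noteq> 0" for n using s[of n] lead\<Omega>[of "s n" "Some i"] by (auto simp: q_def S_def lead_def)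
          have "poly_of_coeffs (N i) (c i (K i)) (l t) \<noteq> 0"
            using lead\<Omega>[OF t, of "Some i"] by (simp add: lead_def)
          then have "(\<lambda>n. 1 + r n / norm (q n)) \<longlonglongrightarrow>
              1 + (\<Sum>k<K i. norm (poly_of_coeffs (N i) (c i k) (l t)))
                / norm (poly_of_coeffs (N i) (c i (K i)) (l t))"
            unfolding q_def r_def by (intro tendsto_intros limp) auto
          then have "convergent (\<lambda>n. 1 + r n / norm (q n))" by (rule convergentI)
          then have "Bseq (\<lambda>n. 1 + r n / norm (q n))" by (rule convergent_imp_Bseq)
          then obtain B where B: "\<And>n. norm (1 + r n / norm (q n)) \<le> B" by (rule BseqE) blast
          have bd: "norm (x n $ i) \<le> 1 + r n / norm (q n)" for n
            unfolding q_def r_def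
            by (rule root_bound[of "\<lambda>k. poly_of_coeffs (N i) (c i k) (l (s n))"])
              (use q0[of n] c(2)[of i "x n"] in \<open>simp_all add: q_def x(2)\<close>)
          have "norm (x n $ i) \<le> B" for n using bd[of n] B[of n] unfolding real_norm_def by linarith
          then show ?thesis by blast
        qed
        then obtain B where B: "\<And>i n. norm (x n $ i) \<le> B i" by metis
        have "norm (x n) \<le> (\<Sum>i\<in>UNIV. B i)" for n
          unfolding norm_vec_def by (rule order_trans[OF L2_set_le_sum]) (auto intro!: sum_mono B)
        then have "\<forall>n. x n \<in> cball 0 (\<Sum>i\<in>UNIV. B i)" by simp
        then obtain z \<rho> where z: "strict_mono \<rho>" "(x \<circ> \<rho>) \<longlonglongrightarrow> z"
          using compact_cball[of "0 :: complex^'n" "\<Sum>i\<in>UNIV. B i", unfolded compact_def,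
              THEN spec, of x] by auto
        have "(\<lambda>n. f ((x \<circ> \<rho>) n)) \<longlonglongrightarrow> f z"
          using continuous_on_tendsto_compose[OF cf z(2)] by simp
        moreover have "(\<lambda>n. f ((x \<circ> \<rho>) n)) \<longlonglongrightarrow> l t"
          using LIMSEQ_subseq_LIMSEQ[OF liml z(1)] by (simp add: x o_def)
        ultimately have fz: "f z = l t" by (rule LIMSEQ_unique)
        have limJ: "(\<lambda>n. J (x (\<rho> n))) \<longlonglongrightarrow> J z"
          using continuous_on_tendsto_compose[OF cJ z(2)] by (simp add: o_def)
        have "(\<lambda>n. \<Sum>k\<le>K'. poly_of_coeffs N' (c' k) (l (s (\<rho> n))) * J (x (\<rho> n)) ^ k)
            \<longlonglongrightarrow> (\<Sum>k\<le>K'. poly_of_coeffs N' (c' k) (l t) * J z ^ k)"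
          by (intro tendsto_intros limJ LIMSEQ_subseq_LIMSEQ[OF limp z(1), unfolded o_def])
        moreover have "(\<Sum>k\<le>K'. poly_of_coeffs N' (c' k) (l (s (\<rho> n))) * J (x (\<rho> n)) ^ k) = 0" for n
          using c'(2)[of "x (\<rho> n)"] x by (simp add: R_def)
        ultimately have eq: "(\<Sum>k\<le>K'. poly_of_coeffs N' (c' k) (l t) * J z ^ k) = 0"
          by (simp add: LIMSEQ_const_iff)
        have "J z \<noteq> 0"
        proof
          assume "J z = 0"
          then have "poly_of_coeffs N' (c' 0) (l t) = 0"
            using eq by (simp add: power_0_left if_distrib[of "\<lambda>u. _ * u"] cong: if_cong)
          then show False using lead\<Omega>[OF t, of None] by (simp add: lead_def)
        qed
        then show "t \<in> S" using t fz unfolding S_def R_def by (metis (mono_tags) IntI imageI mem_Collect_eq vimageI2)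
      qed
      then have "S = \<Omega> \<inter> closure S" using S\<Omega> closure_subset[of S] by blast
      then show ?thesis by (metis closed_closure closedin_closed_Int)
    qed
    moreover have "0 \<in> S" using y0 lead0 by (simp add: S_def \<Omega>_def l01)
    ultimately have "S = \<Omega>" using conn unfolding connected_clopen by blast
    then have sub: "l ` \<Omega> \<subseteq> range f" by (auto simp: S_def)
    \<comment> \<open>The point \<open>y\<close> itself may lie on an excluded hypersurface. Only
      nearby points of the line are then known to be values, which suffices for the closure.\<close>
    have "1 \<in> closure \<Omega>"
      using closure_complement[of "- \<Omega>"] empty_interior_finite[OF fin] by simp
    then have "l 1 \<in> closure (l ` \<Omega>)"
      using image_closure_subset[OF cl closed_closure closure_subset] by blast
    then show ?thesis using sub closure_mono l01 by blast
  qed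
  then show ?thesis by auto
qed

section \<open>Border rank and tangent spaces\<close>

lemma border_rank_le_mono:
  assumes "border_rank_le r T" "r \<le> s"
  shows "border_rank_le s T"
proof -
  obtain A B C where lim: "\<And>i j k. (\<lambda>n. \<Sum>l<r. A n l i * B n l j * C n l k) \<longlonglongrightarrow> T i j k"
    using assms(1) unfolding border_rank_le_def by blast
  define A' where "A' n l i = (if l < r then A n l i else 0)" for n :: nat and l i
  have "(\<Sum>l<s. A' n l i * B n l j * C n l k) = (\<Sum>l<r. A n l i * B n l j * C n l k)" for n i j k
    using assms(2) by (intro sum.mono_neutral_cong_right) (auto simp: A'_def)
  then show ?thesis
    using lim unfolding border_rank_le_def by (intro exI[of _ A'] exI[of _ B] exI[of _ C]) simp
qed

lemma border_rank_eqI: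
  assumes "border_rank_le (Suc r) T" "\<not> border_rank_le r T"
  shows "border_rank T = Suc r"
  unfolding border_rank_def
proof (rule Least_equality)
  show "border_rank_le (Suc r) T" by (rule assms(1))
  fix s assume "border_rank_le s T"
  then show "Suc r \<le> s" using assms(2) border_rank_le_mono not_less_eq_eq by blast
qed

text \<open>Linear maps on the second and third factors act on each rank-one summand separately.
  They serve to rebuild all ambient coordinates from the selected ones.\<close>

lemma border_rank_le_transform:
  fixes T :: "'a::finite \<Rightarrow> 'b::finite \<Rightarrow> 'c::finite \<Rightarrow> complex"
  assumes "border_rank_le r T"
  shows "border_rank_le r (\<lambda>i j k. \<Sum>y\<in>UNIV. \<Sum>z\<in>UNIV. P j y * Q k z * T i y z)"
proof -
  obtain A B C where lim: "\<And>i j k. (\<lambda>n. \<Sum>l<r. A n l i * B n l j * C n l k) \<longlonglongrightarrow> T i j k"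
    using assms(1) unfolding border_rank_le_def by blast
  define B' where "B' n l j = (\<Sum>y\<in>UNIV. P j y * B n l y)" for n l j
  define C' where "C' n l k = (\<Sum>z\<in>UNIV. Q k z * C n l z)" for n l k
  have "(\<Sum>l<r. A n l i * B' n l j * C' n l k)
      = (\<Sum>y\<in>UNIV. \<Sum>z\<in>UNIV. P j y * Q k z * (\<Sum>l<r. A n l i * B n l y * C n l z))" for n i j k
  proof -
    have "(\<Sum>l<r. A n l i * B' n l j * C' n l k)
        = (\<Sum>l<r. \<Sum>y\<in>UNIV. \<Sum>z\<in>UNIV. P j y * Q k z * (A n l i * B n l y * C n l z))"
      unfolding B'_def C'_def
      by (simp add: sum_distrib_left sum_distrib_right mult_ac)
    also have "\<dots> = (\<Sum>y\<in>UNIV. \<Sum>l<r. \<Sum>z\<in>UNIV. P j y * Q k z * (A n l i * B n l y * C n l z))"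
      by (rule sum.swap)
    also have "\<dots> = (\<Sum>y\<in>UNIV. \<Sum>z\<in>UNIV. \<Sum>l<r. P j y * Q k z * (A n l i * B n l y * C n l z))"
      by (intro sum.cong refl sum.swap)
    finally show ?thesis by (simp add: sum_distrib_left)
  qed
  moreover have "(\<lambda>n. \<Sum>y\<in>UNIV. \<Sum>z\<in>UNIV. P j y * Q k z * (\<Sum>l<r. A n l i * B n l y * C n l z))
      \<longlonglongrightarrow> (\<Sum>y\<in>UNIV. \<Sum>z\<in>UNIV. P j y * Q k z * T i y z)" for i j k
    by (intro tendsto_intros lim)
  ultimately show ?thesis unfolding border_rank_le_def by (intro exI[of _ A] exI[of _ B'] exI[of _ C']) simp
qed

lemma border_rank_le_reindex:
  "border_rank_le r T \<Longrightarrow> border_rank_le r (\<lambda>i j k. T i (J j) (K k))"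
  unfolding border_rank_le_def
proof (elim exE)
  fix A B C
  assume "\<forall>i j k. (\<lambda>n. \<Sum>l<r. A n l i * B n l j * C n l k) \<longlonglongrightarrow> T i j k"
  then show "\<exists>A B C. \<forall>i j k. (\<lambda>n. \<Sum>l<r. A n l i * B n l j * C n l k) \<longlonglongrightarrow> T i (J j) (K k)"
    by (intro exI[of _ A] exI[of _ "\<lambda>n l j. B n l (J j)"] exI[of _ "\<lambda>n l k. C n l (K k)"]) blast
qed

text \<open>Duality: varying one factor at a time, the three hypotheses on \<open>\<Phi>\<close> say
  that it annihilates the tangent spaces at all \<open>r\<close> points. If these did not span, the
  conjugate of a vector orthogonal to them would be a nonzero annihilator.\<close>

lemma tangents_span_everything:
  fixes a :: "nat \<Rightarrow> 'a::finite \<Rightarrow> complex" and b :: "nat \<Rightarrow> 'b::finite \<Rightarrow> complex"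
    and c :: "nat \<Rightarrow> 'c::finite \<Rightarrow> complex"
  assumes annihilator: "\<And>\<Phi> :: 'a \<Rightarrow> 'b \<Rightarrow> 'c \<Rightarrow> complex.
    (\<And>l i. l < r \<Longrightarrow> (\<Sum>j\<in>UNIV. \<Sum>k\<in>UNIV. b l j * c l k * \<Phi> i j k) = 0) \<Longrightarrow>
    (\<And>l j. l < r \<Longrightarrow> (\<Sum>i\<in>UNIV. \<Sum>k\<in>UNIV. a l i * c l k * \<Phi> i j k) = 0) \<Longrightarrow>
    (\<And>l k. l < r \<Longrightarrow> (\<Sum>i\<in>UNIV. \<Sum>j\<in>UNIV. a l i * b l j * \<Phi> i j k) = 0) \<Longrightarrow>
    \<Phi> = (\<lambda>_ _ _. 0)"
  shows "\<exists>\<alpha> \<beta> \<gamma>. \<forall>i j k. (\<Sum>l<r. \<alpha> l i * b l j * c l k + a l i * \<beta> l j * c l k + a l i * b l j * \<gamma> l k)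
    = T i j k"
proof -
  define tan where "tan \<alpha> \<beta> \<gamma> = (\<chi> p. \<Sum>l<r. \<alpha> l (fst p) * b l (fst (snd p)) * c l (snd (snd p))
      + a l (fst p) * \<beta> l (fst (snd p)) * c l (snd (snd p))
      + a l (fst p) * b l (fst (snd p)) * \<gamma> l (snd (snd p)))" for \<alpha> \<beta> \<gamma>
  define V :: "(complex^('a \<times> 'b \<times> 'c)) set" where "V = {v. \<exists>\<alpha> \<beta> \<gamma>. v = tan \<alpha> \<beta> \<gamma>}"
  have tan_in: "tan \<alpha> \<beta> \<gamma> \<in> V" for \<alpha> \<beta> \<gamma> by (auto simp: V_def)
  have cscale: "(\<chi> p. z * v $ p) \<in> V" if vV: "v \<in> V" for z v
  proof -
    obtain \<alpha> \<beta> \<gamma> where v: "v = tan \<alpha> \<beta> \<gamma>" using vV by (auto simp: V_def)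
    have "(\<chi> p. z * v $ p) = tan (\<lambda>l i. z * \<alpha> l i) (\<lambda>l i. z * \<beta> l i) (\<lambda>l i. z * \<gamma> l i)"
      by (simp add: v tan_def vec_eq_iff sum_distrib_left algebra_simps)
    then show ?thesis by (simp add: tan_in)
  qed
  have "subspace V"
    unfolding subspace_def
  proof (intro conjI ballI allI)
    have "0 = tan (\<lambda>_ _. 0) (\<lambda>_ _. 0) (\<lambda>_ _. 0)" by (simp add: tan_def vec_eq_iff)
    then show "0 \<in> V" by (metis tan_in)
    fix u v assume "u \<in> V" "v \<in> V"
    then obtain \<alpha> \<beta> \<gamma> \<alpha>' \<beta>' \<gamma>' where "u = tan \<alpha> \<beta> \<gamma>" "v = tan \<alpha>' \<beta>' \<gamma>'" by (auto simp: V_def)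
    then have "u + v = tan (\<lambda>l i. \<alpha> l i + \<alpha>' l i) (\<lambda>l i. \<beta> l i + \<beta>' l i) (\<lambda>l i. \<gamma> l i + \<gamma>' l i)"
      by (simp add: tan_def vec_eq_iff sum.distrib algebra_simps)
    then show "u + v \<in> V" by (simp add: tan_in)
  next
    fix t :: real and v assume "v \<in> V"
    moreover have "t *\<^sub>R v = (\<chi> p. of_real t * v $ p)"
      unfolding vec_eq_iff vector_scaleR_component vec_lambda_beta by (simp add: scaleR_conv_of_real)
    ultimately show "t *\<^sub>R v \<in> V" using cscale by simp
  qed
  then have "span V = V" by (rule span_eq_iff[THEN iffD2])
  have "V = UNIV"
  proof (rule ccontr)
    assume "V \<noteq> UNIV"
    then obtain w where w: "w \<noteq> 0" "\<And>v. v \<in> V \<Longrightarrow> w \<bullet> v = 0"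
      using span_not_UNIV_orthogonal[of V] \<open>span V = V\<close> by auto
    \<comment> \<open>Orthogonality is available for the real inner product, which is the real part
      of this sum. The imaginary part follows because \<open>V\<close> is closed under
      multiplication by \<open>- \<i>\<close>.\<close>
    have orth: "(\<Sum>p\<in>UNIV. cnj (w$p) * v$p) = 0" if "v \<in> V" for v
    proof (rule complex_eqI)
      have Re: "w \<bullet> v = Re (\<Sum>p\<in>UNIV. cnj (w$p) * v$p)" for v
        by (simp add: inner_vec_def inner_complex_def)
      show "Re (\<Sum>p\<in>UNIV. cnj (w$p) * v$p) = Re 0" using w(2)[OF that] Re by simp
      have "w \<bullet> (\<chi> p. - \<i> * v$p) = Im (\<Sum>p\<in>UNIV. cnj (w$p) * v$p)"
        by (simp add: Re)
      then show "Im (\<Sum>p\<in>UNIV. cnj (w$p) * v$p) = Im 0"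
        using w(2)[OF cscale[OF that, of "- \<i>"]] by simp
    qed
    define \<Phi> where "\<Phi> i j k = cnj (w $ (i, j, k))" for i j k
    have orth': "(\<Sum>i\<in>UNIV. \<Sum>j\<in>UNIV. \<Sum>k\<in>UNIV. \<Phi> i j k * tan \<alpha> \<beta> \<gamma> $ (i, j, k)) = 0" for \<alpha> \<beta> \<gamma>
      using orth[OF tan_in, of \<alpha> \<beta> \<gamma>]
      by (simp add: \<Phi>_def sum.cartesian_product UNIV_Times_UNIV case_prod_beta)
    have "\<Phi> = (\<lambda>_ _ _. 0)"
    proof (rule annihilator)
      fix m x assume m: "m < r"
      define \<tau> where "\<tau> = tan (\<lambda>l y. if l = m \<and> y = x then 1 else 0) (\<lambda>_ _. 0) (\<lambda>_ _. 0)"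
      have \<tau>: "\<tau> $ (i, j, k) = (if i = x then b m j * c m k else 0)" for i j k
        using m by (simp add: \<tau>_def tan_def if_distrib[of "\<lambda>t. t * _"] if_distrib[of "\<lambda>t. _ * t"] cong: if_cong)
      have "(\<Sum>i\<in>UNIV. if i = x then (\<Sum>j\<in>UNIV. \<Sum>k\<in>UNIV. \<Phi> i j k * (b m j * c m k)) else 0)
          = (\<Sum>i\<in>UNIV. \<Sum>j\<in>UNIV. \<Sum>k\<in>UNIV. \<Phi> i j k * \<tau> $ (i, j, k))"
        by (intro sum.cong refl) (simp add: \<tau>)
      also have "\<dots> = 0" unfolding \<tau>_def by (rule orth')
      finally show "(\<Sum>j\<in>UNIV. \<Sum>k\<in>UNIV. b m j * c m k * \<Phi> x j k) = 0" by (simp add: mult_ac)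
    next
      fix m x assume m: "m < r"
      define \<tau> where "\<tau> = tan (\<lambda>_ _. 0) (\<lambda>l y. if l = m \<and> y = x then 1 else 0) (\<lambda>_ _. 0)"
      have \<tau>: "\<tau> $ (i, j, k) = (if j = x then a m i * c m k else 0)" for i j k
        using m by (simp add: \<tau>_def tan_def if_distrib[of "\<lambda>t. t * _"] if_distrib[of "\<lambda>t. _ * t"] cong: if_cong)
      have "(\<Sum>i\<in>UNIV. \<Sum>j\<in>UNIV. if j = x then (\<Sum>k\<in>UNIV. \<Phi> i j k * (a m i * c m k)) else 0)
          = (\<Sum>i\<in>UNIV. \<Sum>j\<in>UNIV. \<Sum>k\<in>UNIV. \<Phi> i j k * \<tau> $ (i, j, k))"
        by (intro sum.cong refl) (simp add: \<tau>)
      also have "\<dots> = 0" unfolding \<tau>_def by (rule orth')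
      finally show "(\<Sum>i\<in>UNIV. \<Sum>k\<in>UNIV. a m i * c m k * \<Phi> i x k) = 0" by (simp add: mult_ac)
    next
      fix m x assume m: "m < r"
      define \<tau> where "\<tau> = tan (\<lambda>_ _. 0) (\<lambda>_ _. 0) (\<lambda>l y. if l = m \<and> y = x then 1 else 0)"
      have \<tau>: "\<tau> $ (i, j, k) = (if k = x then a m i * b m j else 0)" for i j k
        using m by (simp add: \<tau>_def tan_def if_distrib[of "\<lambda>t. t * _"] if_distrib[of "\<lambda>t. _ * t"] cong: if_cong)
      have "(\<Sum>i\<in>UNIV. \<Sum>j\<in>UNIV. \<Sum>k\<in>UNIV. if k = x then \<Phi> i j k * (a m i * b m j) else 0)
          = (\<Sum>i\<in>UNIV. \<Sum>j\<in>UNIV. \<Sum>k\<in>UNIV. \<Phi> i j k * \<tau> $ (i, j, k))"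
        by (intro sum.cong refl) (simp add: \<tau>)
      also have "\<dots> = 0" unfolding \<tau>_def by (rule orth')
      finally show "(\<Sum>i\<in>UNIV. \<Sum>j\<in>UNIV. a m i * b m j * \<Phi> i j x) = 0" by (simp add: mult_ac)
    qed
    then have "w = 0" by (auto simp: vec_eq_iff \<Phi>_def fun_eq_iff)
    then show False using w by simp
  qed
  then have "(\<chi> p. T (fst p) (fst (snd p)) (snd (snd p))) \<in> V" by simp
  then obtain \<alpha> \<beta> \<gamma> where "(\<chi> p. T (fst p) (fst (snd p)) (snd (snd p))) = tan \<alpha> \<beta> \<gamma>"
    by (auto simp: V_def)
  then have "tan \<alpha> \<beta> \<gamma> $ (i, j, k) = T i j k" for i j k by (simp add: vec_eq_iff)
  then show ?thesis unfolding tan_def vec_lambda_beta fst_conv snd_conv by blast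
qed

lemma has_derivative_vec_lambda:
  fixes f :: "'i::finite \<Rightarrow> 'v::real_normed_vector \<Rightarrow> complex"
  assumes "\<And>i. (f i has_derivative f' i) F"
  shows "((\<lambda>x. \<chi> i. f i x) has_derivative (\<lambda>h. \<chi> i. f' i h)) F"
proof -
  have sum_axis: "(\<chi> i. g i) = (\<Sum>i\<in>UNIV. axis i (g i))" for g :: "'i \<Rightarrow> complex"
    by (simp add: vec_eq_iff axis_def)
  have "bounded_linear (axis i :: complex \<Rightarrow> complex^'i)" for i
    by (intro linear_conv_bounded_linear[THEN iffD1] linearI) (simp_all add: vec_eq_iff axis_def)
  then show ?thesis
    unfolding sum_axis
    by (intro has_derivative_sum) (rule bounded_linear.has_derivative, assumption, rule assms)
qed

text \<open>The factors may have more entries than the target has coordinates, but the density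
  theorem compares spaces of equal dimension. So for each target coordinate \<open>p\<close> one
  tangent direction mapping to the p-th basis tensor is fixed, and the factors vary only along these
  directions. The derivative at 0 is then the identity matrix.\<close>

lemma border_rank_le_of_tangents:
  fixes a :: "nat \<Rightarrow> 'a::finite \<Rightarrow> complex" and b :: "nat \<Rightarrow> 'b::finite \<Rightarrow> complex"
    and c :: "nat \<Rightarrow> 'c::finite \<Rightarrow> complex"
  assumes tangent: "\<And>T :: 'a \<Rightarrow> 'b \<Rightarrow> 'c \<Rightarrow> complex. \<exists>\<alpha> \<beta> \<gamma>. \<forall>i j k.
    (\<Sum>l<r. \<alpha> l i * b l j * c l k + a l i * \<beta> l j * c l k + a l i * b l j * \<gamma> l k) = T i j k"
  shows "border_rank_le r (T :: 'a \<Rightarrow> 'b \<Rightarrow> 'c \<Rightarrow> complex)"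
proof -
  define rel where "rel p \<alpha> \<beta> \<gamma> \<longleftrightarrow> (\<forall>i j k.
      (\<Sum>l<r. \<alpha> l i * b l j * c l k + a l i * \<beta> l j * c l k + a l i * b l j * \<gamma> l k)
      = (if (i, j, k) = p then 1 else 0))" for p \<alpha> \<beta> \<gamma>
  have "\<exists>\<alpha> \<beta> \<gamma>. rel p \<alpha> \<beta> \<gamma>" for p unfolding rel_def by (rule tangent)
  then obtain \<alpha> \<beta> \<gamma> where "\<And>p. rel p (\<alpha> p) (\<beta> p) (\<gamma> p)" by metis
  then have dual: "(\<Sum>l<r. \<alpha> p l i * b l j * c l k + a l i * \<beta> p l j * c l k + a l i * b l j * \<gamma> p l k)
      = (if (i, j, k) = p then 1 else 0)" for p i j k
    by (simp add: rel_def)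
  define A where "A u l i = a l i + (\<Sum>p\<in>UNIV. \<alpha> p l i * u$p)" for u :: "complex^('a \<times> 'b \<times> 'c)" and l i
  define B where "B u l i = b l i + (\<Sum>p\<in>UNIV. \<beta> p l i * u$p)" for u :: "complex^('a \<times> 'b \<times> 'c)" and l i
  define C where "C u l i = c l i + (\<Sum>p\<in>UNIV. \<gamma> p l i * u$p)" for u :: "complex^('a \<times> 'b \<times> 'c)" and l i
  define F where "F u = (\<chi> q. \<Sum>l<r. A u l (fst q) * B u l (fst (snd q)) * C u l (snd (snd q)))" for u
  define dF where "dF u = (\<chi> q p. \<Sum>l<r. \<alpha> p l (fst q) * B u l (fst (snd q)) * C u l (snd (snd q))
      + A u l (fst q) * \<beta> p l (fst (snd q)) * C u l (snd (snd q))
      + A u l (fst q) * B u l (fst (snd q)) * \<gamma> p l (snd (snd q)))" for u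
  have pA: "poly_fun 1 (\<lambda>u. A u l i)" and pB: "poly_fun 1 (\<lambda>u. B u l j)" and pC: "poly_fun 1 (\<lambda>u. C u l k)"
    for l i j k unfolding A_def B_def C_def
    by (intro poly_fun_add poly_fun_const poly_fun_sum poly_fun_cmult poly_fun_coordinate)+
  have "closure (range F) = UNIV"
  proof (rule dominant_polynomial_map_dense)
    show "poly_fun (1 + 1 + 1) (\<lambda>u. F u $ q)" for q
      unfolding F_def vec_lambda_beta by (intro poly_fun_sum poly_fun_mult pA pB pC)
    show "poly_fun (1 + 1 + 1) (\<lambda>u. dF u $ q $ p)" for q p
      unfolding dF_def vec_lambda_beta
      by (intro poly_fun_sum poly_fun_add poly_fun_mult pA pB pC poly_fun_const)
    have "dF 0 = mat 1"
      by (simp add: dF_def A_def B_def C_def vec_eq_iff mat_def dual)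
    then show "det (dF 0) \<noteq> 0" by simp
    fix u
    have dA: "((\<lambda>u. A u l i) has_derivative (\<lambda>v. \<Sum>p\<in>UNIV. \<alpha> p l i * v$p)) (at u)" for l i
      unfolding A_def by (auto intro!: derivative_eq_intros bounded_linear.has_derivative[OF bounded_linear_vec_nth])
    have dB: "((\<lambda>u. B u l i) has_derivative (\<lambda>v. \<Sum>p\<in>UNIV. \<beta> p l i * v$p)) (at u)" for l i
      unfolding B_def by (auto intro!: derivative_eq_intros bounded_linear.has_derivative[OF bounded_linear_vec_nth])
    have dC: "((\<lambda>u. C u l i) has_derivative (\<lambda>v. \<Sum>p\<in>UNIV. \<gamma> p l i * v$p)) (at u)" for l i
      unfolding C_def by (auto intro!: derivative_eq_intros bounded_linear.has_derivative[OF bounded_linear_vec_nth])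
    have "(F has_derivative (\<lambda>v. \<chi> q. \<Sum>l<r. A u l (fst q) * B u l (fst (snd q)) * (\<Sum>p\<in>UNIV. \<gamma> p l (snd (snd q)) * v$p)
        + (A u l (fst q) * (\<Sum>p\<in>UNIV. \<beta> p l (fst (snd q)) * v$p)
          + (\<Sum>p\<in>UNIV. \<alpha> p l (fst q) * v$p) * B u l (fst (snd q))) * C u l (snd (snd q)))) (at u)"
      unfolding F_def by (intro has_derivative_vec_lambda has_derivative_sum has_derivative_mult dA dB dC)
    moreover have "(\<chi> q. \<Sum>l<r. A u l (fst q) * B u l (fst (snd q)) * (\<Sum>p\<in>UNIV. \<gamma> p l (snd (snd q)) * v$p)
        + (A u l (fst q) * (\<Sum>p\<in>UNIV. \<beta> p l (fst (snd q)) * v$p)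
          + (\<Sum>p\<in>UNIV. \<alpha> p l (fst q) * v$p) * B u l (fst (snd q))) * C u l (snd (snd q)))
        = dF u *v v" for v
      unfolding vec_eq_iff matrix_vector_mult_def dF_def vec_lambda_beta sum_distrib_right
      by (subst sum.swap) (simp add: sum.distrib sum_distrib_left sum_distrib_right algebra_simps)
    ultimately show "(F has_derivative (\<lambda>v. dF u *v v)) (at u)" by simp
  qed
  then have "(\<chi> q. T (fst q) (fst (snd q)) (snd (snd q))) \<in> closure (range F)" by simp
  then obtain v where v: "\<And>n. v n \<in> range F" "v \<longlonglongrightarrow> (\<chi> q. T (fst q) (fst (snd q)) (snd (snd q)))"
    unfolding closure_sequential by blast
  then have "\<forall>n. \<exists>u. v n = F u" by blast
  then obtain u where u: "\<And>n. v n = F (u n)" by metis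
  have "(\<lambda>n. v n $ (i, j, k)) \<longlonglongrightarrow> T i j k" for i j k
    using tendsto_vec_nth[OF v(2), of "(i, j, k)"] by simp
  then show ?thesis
    unfolding border_rank_le_def u F_def
    by (intro exI[of _ "\<lambda>n. A (u n)"] exI[of _ "\<lambda>n. B (u n)"] exI[of _ "\<lambda>n. C (u n)"]) simp
qed

section \<open>Tensors of border rank at most nine\<close>

text \<open>A sum of a_l (x) b_l (x) c_l (l < 9) is contracted by s to a symmetric tensor, a combination of the
  a_l (x) a_l (x) a_l (x) c_l, as soon as s(b_l) is a multiple of a_l (x) a_l for all l: these are
  54 equations for the 57 unknowns s and the multiples.\<close>

lemma rank_nine_symmetric_witness:
  fixes A :: "nat \<Rightarrow> 3 \<Rightarrow> complex" and B :: "nat \<Rightarrow> 'b::finite \<Rightarrow> complex" and C :: "nat \<Rightarrow> 'c \<Rightarrow> complex"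
  assumes card: "CARD('b) = 8"
  obtains s where "s \<noteq> (\<lambda>_ _ _. 0)" "\<And>a b x. s a b x = s b a x"
    "\<And>a b c k. (\<Sum>x\<in>UNIV. s a b x * (\<Sum>l<9. A l c * B l x * C l k))
       = (\<Sum>x\<in>UNIV. s a c x * (\<Sum>l<9. A l b * B l x * C l k))"
proof -
  \<comment> \<open>If \<open>A l\<close> were zero, its multiple would be unconstrained and the
    solution of the linear system could have \<open>s = 0\<close>. Taking a nonzero default for
    \<open>A' l\<close> and zero for \<open>B' l\<close> keeps the products unchanged and forces all
    multiples to vanish with \<open>s\<close>.\<close>
  define A' where "A' l = (if A l = (\<lambda>_. 0) then (\<lambda>_. 1) else A l)" for l
  define B' where "B' l = (if A l = (\<lambda>_. 0) then (\<lambda>_. 0) else B l)" for l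
  have A'_nz: "\<exists>a. A' l a \<noteq> 0" for l by (auto simp: A'_def fun_eq_iff)
  have AB: "A l a * B l x = A' l a * B' l x" for l a x by (simp add: A'_def B'_def)
  define P :: "(3 \<times> 3) set" where "P = {(1,1), (1,2), (1,3), (2,2), (2,3), (3,3)}"
  have P: "card P = 6" "finite P" by (simp_all add: P_def)
  have P_cases: "(a, b) \<in> P \<or> (b, a) \<in> P" for a b
    using exhaust_3[of a] exhaust_3[of b] by (auto simp: P_def)
  \<comment> \<open>The unknowns are the nine multiples and the 6 * 8 entries of \<open>s\<close>
    over the pairs in \<open>P\<close>; the other entries of \<open>s\<close> follow by
    symmetry.\<close>
  define M :: "(nat + (3 \<times> 3) \<times> 'b) set" where "M = {..<9} <+> (P \<times> UNIV)"
  define E where "E = {..<9::nat} \<times> P"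
  define Q where "Q m e = (case m of
      Inl l \<Rightarrow> if l = fst e then - (A' l (fst (snd e)) * A' l (snd (snd e))) else 0
    | Inr (p, x) \<Rightarrow> if p = snd e then B' (fst e) x else 0)" for m :: "nat + (3 \<times> 3) \<times> 'b" and e
  have "card E < card M" by (simp add: E_def M_def card_Plus card_cartesian_product P card)
  moreover have "finite E" "finite M" using P by (auto simp: E_def M_def)
  ultimately obtain c where c: "\<exists>m\<in>M. c m \<noteq> 0" "\<forall>e\<in>E. (\<Sum>m\<in>M. c m * Q m e) = 0"
    using underdetermined_system[of E M Q] by blast
  define s where "s a b x = (if (a, b) \<in> P then c (Inr ((a, b), x)) else c (Inr ((b, a), x)))" for a b x
  have sym: "s a b x = s b a x" for a b x
    using exhaust_3[of a] exhaust_3[of b] by (auto simp: s_def P_def)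
  have "(\<Sum>x\<in>UNIV. s a b x * B' l x) = c (Inl l) * A' l a * A' l b" if l: "l < 9" and ab: "(a, b) \<in> P" for l a b
  proof -
    have "(\<Sum>m\<in>M. c m * Q m (l, (a, b))) = (\<Sum>l'<9. c (Inl l') * Q (Inl l') (l, (a, b)))
        + (\<Sum>(p, x)\<in>P \<times> UNIV. c (Inr (p, x)) * Q (Inr (p, x)) (l, (a, b)))"
      using P unfolding M_def by (subst sum.Plus) (auto simp: case_prod_beta)
    also have "(\<Sum>l'<9. c (Inl l') * Q (Inl l') (l, (a, b))) = - (c (Inl l) * A' l a * A' l b)"
      using l by (simp add: Q_def if_distrib[of "\<lambda>t. _ * t"] cong: if_cong)
    also have "(\<Sum>(p, x)\<in>P \<times> UNIV. c (Inr (p, x)) * Q (Inr (p, x)) (l, (a, b)))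
        = (\<Sum>p\<in>P. if p = (a, b) then (\<Sum>x\<in>UNIV. c (Inr (p, x)) * B' l x) else 0)"
      unfolding sum.cartesian_product[symmetric] by (intro sum.cong) (auto simp: Q_def)
    also have "\<dots> = (\<Sum>x\<in>UNIV. s a b x * B' l x)" using P ab by (simp add: s_def)
    finally show ?thesis using c(2) l ab by (simp add: E_def)
  qed
  then have key: "(\<Sum>x\<in>UNIV. s a b x * B' l x) = c (Inl l) * A' l a * A' l b" if "l < 9" for l a b
    using P_cases[of a b] that by (force simp: sym[of a b] mult_ac)
  have expand: "(\<Sum>x\<in>UNIV. s a b x * (\<Sum>l<9. A l d * B l x * C l k))
      = (\<Sum>l<9. c (Inl l) * A' l a * A' l b * A' l d * C l k)" for a b d k
  proof -
    have "(\<Sum>x\<in>UNIV. s a b x * (\<Sum>l<9. A l d * B l x * C l k))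
        = (\<Sum>l<9. \<Sum>x\<in>UNIV. s a b x * B' l x * (A' l d * C l k))"
      unfolding AB sum_distrib_left by (subst sum.swap) (simp add: mult_ac)
    also have "\<dots> = (\<Sum>l<9. (\<Sum>x\<in>UNIV. s a b x * B' l x) * (A' l d * C l k))"
      by (simp only: sum_distrib_right)
    also have "\<dots> = (\<Sum>l<9. c (Inl l) * A' l a * A' l b * A' l d * C l k)"
      by (intro sum.cong) (auto simp: key)
    finally show ?thesis .
  qed
  show ?thesis
  proof
    show "s a b x = s b a x" for a b x by (rule sym)
    show "(\<Sum>x\<in>UNIV. s a b x * (\<Sum>l<9. A l d * B l x * C l k))
       = (\<Sum>x\<in>UNIV. s a d x * (\<Sum>l<9. A l b * B l x * C l k))" for a b d k
      unfolding expand by (simp add: mult_ac)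
    show "s \<noteq> (\<lambda>_ _ _. 0)"
    proof
      assume s0: "s = (\<lambda>_ _ _. 0)"
      have "c (Inl l) = 0" if "l < 9" for l
        using A'_nz[of l] key[OF that] by (auto simp: s0)
      moreover have "c (Inr (p, x)) = 0" if "p \<in> P" for p x
        using that fun_cong[OF fun_cong[OF fun_cong[OF s0]], of "fst p" "snd p" x] by (simp add: s_def)
      ultimately show False using c(1) by (auto simp: M_def)
    qed
  qed
qed

text \<open>Nonexistence of a nonzero s as in the previous lemma is an open condition on T.\<close>

lemma not_border_rank_le_nine:
  fixes T :: "3 \<Rightarrow> 'b::finite \<Rightarrow> 'c::finite \<Rightarrow> complex"
  assumes card: "CARD('b) = 8"
    and inj: "\<And>s :: 3 \<Rightarrow> 3 \<Rightarrow> 'b \<Rightarrow> complex. (\<And>a b x. s a b x = s b a x) \<Longrightarrow>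
      (\<And>a b c k. (\<Sum>x\<in>UNIV. s a b x * T c x k) = (\<Sum>x\<in>UNIV. s a c x * T b x k)) \<Longrightarrow> s = (\<lambda>_ _ _. 0)"
  shows "\<not> border_rank_le 9 T"
proof
  assume "border_rank_le 9 T"
  then obtain A B C where lim: "\<And>i j k. (\<lambda>n. \<Sum>l<9::nat. A n l i * B n l j * C n l k) \<longlonglongrightarrow> T i j k"
    unfolding border_rank_le_def by blast
  define U where "U n i j k = (\<Sum>l<9::nat. A n l i * B n l j * C n l k)" for n i j k
  \<comment> \<open>Unit norm keeps the limit of the witnesses away from zero, and compactness of
    the sphere provides the limit; the remaining conditions are closed.\<close>
  define good where "good n v \<longleftrightarrow> norm v = 1 \<and> (\<forall>a b x. v $ (a, b, x) = v $ (b, a, x)) \<and>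
      (\<forall>a b c k. (\<Sum>x\<in>UNIV. v $ (a, b, x) * U n c x k) = (\<Sum>x\<in>UNIV. v $ (a, c, x) * U n b x k))"
    for n and v :: "complex^(3 \<times> 3 \<times> 'b)"
  have "\<exists>v. good n v" for n
  proof -
    obtain s where s: "s \<noteq> (\<lambda>_ _ _. 0)" "\<And>a b x. s a b x = s b a x"
      "\<And>a b c k. (\<Sum>x\<in>UNIV. s a b x * U n c x k) = (\<Sum>x\<in>UNIV. s a c x * U n b x k)"
      using rank_nine_symmetric_witness[OF card, of "A n" "B n" "C n"] unfolding U_def by blast
    define w :: "complex^(3 \<times> 3 \<times> 'b)" where "w = (\<chi> p. s (fst p) (fst (snd p)) (snd (snd p)))"
    have "w \<noteq> 0" using s(1) by (auto simp: w_def vec_eq_iff fun_eq_iff)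
    define t where "t = complex_of_real (1 / norm w)"
    have "norm ((1 / norm w) *\<^sub>R w) = 1" using \<open>w \<noteq> 0\<close> by simp
    moreover have "((1 / norm w) *\<^sub>R w) $ (a, b, x) = t * s a b x" for a b x
      unfolding vector_scaleR_component by (simp add: w_def t_def scaleR_conv_of_real)
    ultimately have "good n ((1 / norm w) *\<^sub>R w)"
      unfolding good_def using s(2,3) by (simp add: mult.assoc flip: sum_distrib_left)
    then show ?thesis by blast
  qed
  then obtain v where v: "\<And>n. good n (v n)" by metis
  have "\<forall>n. v n \<in> sphere 0 1" using v by (simp add: good_def)
  then obtain w \<rho> where w: "w \<in> sphere 0 1" "strict_mono \<rho>" "(v \<circ> \<rho>) \<longlonglongrightarrow> w"
    using compact_sphere[of "0 :: complex^(3 \<times> 3 \<times> 'b)" 1, unfolded compact_def, THEN spec, of v] by auto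
  have lv: "(\<lambda>n. v (\<rho> n) $ p) \<longlonglongrightarrow> w $ p" for p
    using tendsto_vec_nth[OF w(3)] by (simp add: o_def)
  have lU: "(\<lambda>n. U (\<rho> n) i j k) \<longlonglongrightarrow> T i j k" for i j k
    using LIMSEQ_subseq_LIMSEQ[OF lim w(2)] by (simp add: U_def o_def)
  have "(\<lambda>a b x. w $ (a, b, x)) = (\<lambda>_ _ _. 0)"
  proof (rule inj)
    fix a b x
    have "(\<lambda>n. v (\<rho> n) $ (a, b, x)) = (\<lambda>n. v (\<rho> n) $ (b, a, x))" using v by (simp add: good_def)
    then show "w $ (a, b, x) = w $ (b, a, x)"
      using LIMSEQ_unique[OF lv[of "(a, b, x)"], of "w $ (b, a, x)"] lv[of "(b, a, x)"] by simp
  next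
    fix a b c k
    have eq: "(\<lambda>n. \<Sum>x\<in>UNIV. v (\<rho> n) $ (a, b, x) * U (\<rho> n) c x k)
        = (\<lambda>n. \<Sum>x\<in>UNIV. v (\<rho> n) $ (a, c, x) * U (\<rho> n) b x k)"
      using v unfolding good_def by blast
    have lim: "(\<lambda>n. \<Sum>x\<in>UNIV. v (\<rho> n) $ (a, b, x) * U (\<rho> n) c x k)
        \<longlonglongrightarrow> (\<Sum>x\<in>UNIV. w $ (a, b, x) * T c x k)" for a b c k
      by (intro tendsto_intros lv lU)
    show "(\<Sum>x\<in>UNIV. w $ (a, b, x) * T c x k) = (\<Sum>x\<in>UNIV. w $ (a, c, x) * T b x k)"
      using lim[of a b c k] unfolding eq by (rule LIMSEQ_unique[OF _ lim])
  qed
  then have "w = 0" by (auto simp: vec_eq_iff fun_eq_iff)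
  then show False using w(1) by simp
qed

section \<open>Border rank in format 3 x 8 x 6\<close>

text \<open>A sparse point of the tenth secant variety of the Segre variety at which the tangent
  spaces span everything, found by computer search.\<close>

definition terracini_a :: "nat list list" where
  "terracini_a = [[0,1,0],
     [0,1,0],
     [0,1,1],
     [0,1,1],
     [0,0,1],
     [1,0,0],
     [1,0,0],
     [1,0,1],
     [1,1,0],
     [1,1,1]]"

definition terracini_b :: "nat list list" where
  "terracini_b = [[1,0,0,0,0,0,0,0],
     [0,1,0,0,0,0,0,0],
     [0,0,1,0,0,0,0,0],
     [0,0,0,1,0,0,0,0],
     [0,0,0,0,1,0,0,0],
     [0,0,0,0,0,1,0,0],
     [0,0,0,0,0,0,1,0],
     [0,0,0,0,0,0,0,1],
     [0,1,1,0,0,0,1,1],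
     [1,0,0,1,1,1,0,0]]"

definition terracini_c :: "nat list list" where
  "terracini_c = [[1,0,0,0,0,0],
     [0,1,0,0,0,0],
     [0,1,1,0,0,0],
     [0,0,0,1,0,0],
     [0,0,0,0,1,0],
     [0,0,0,0,0,1],
     [1,0,0,1,1,0],
     [0,0,0,1,0,1],
     [1,0,1,0,0,0],
     [0,1,0,0,1,0]]"

lemma all_less_numeral: "(\<forall>i<numeral n. P i) \<longleftrightarrow> P (pred_numeral n) \<and> (\<forall>i<pred_numeral n. P i)"
  by (simp add: numeral_eq_Suc All_less_Suc)

lemma sum_less_numeral: "(\<Sum>i<numeral n. f i) = (\<Sum>i<pred_numeral n. f i) + (f (pred_numeral n) :: complex)"
  by (simp add: numeral_eq_Suc)

text \<open>The spanning condition in dual form: 170 equations for 144 unknowns. Entries 0 and 1,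
  with unit vectors as the first eight members of \<open>terracini_b\<close>, keep the equations
  short enough for repeated substitution. Natural numbers as indices let the sums and bounded
  quantifiers unfold.\<close>

lemma terracini_annihilator_zero:
  fixes \<Phi> :: "nat \<Rightarrow> nat \<Rightarrow> nat \<Rightarrow> complex"
  assumes "\<forall>l<10. \<forall>i<3. (\<Sum>j<8. \<Sum>k<6. of_nat (terracini_b ! l ! j) * of_nat (terracini_c ! l ! k) * \<Phi> i j k) = 0"
    and "\<forall>l<10. \<forall>j<8. (\<Sum>i<3. \<Sum>k<6. of_nat (terracini_a ! l ! i) * of_nat (terracini_c ! l ! k) * \<Phi> i j k) = 0"
    and "\<forall>l<10. \<forall>k<6. (\<Sum>i<3. \<Sum>j<8. of_nat (terracini_a ! l ! i) * of_nat (terracini_b ! l ! j) * \<Phi> i j k) = 0"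
  shows "\<forall>i<3. \<forall>j<8. \<forall>k<6. \<Phi> i j k = 0"
proof -
  note [simp] = all_less_numeral sum_less_numeral
  note E0 = assms[unfolded terracini_a_def terracini_b_def terracini_c_def, simplified]
  \<comment> \<open>In each round the equations with exactly one remaining unknown are solved.\<close>
  have z1:
    "\<Phi> 0 0 0 = 0 \<and> \<Phi> 0 0 5 = 0 \<and> \<Phi> 0 1 1 = 0 \<and> \<Phi> 0 1 5 = 0 \<and>
      \<Phi> 0 2 5 = 0 \<and> \<Phi> 0 3 3 = 0 \<and> \<Phi> 0 3 5 = 0 \<and> \<Phi> 0 4 4 = 0 \<and>
      \<Phi> 0 4 5 = 0 \<and> \<Phi> 0 5 0 = 0 \<and> \<Phi> 0 5 1 = 0 \<and> \<Phi> 0 5 2 = 0 \<and>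
      \<Phi> 0 5 3 = 0 \<and> \<Phi> 0 5 4 = 0 \<and> \<Phi> 0 5 5 = 0 \<and> \<Phi> 0 6 0 = 0 \<and>
      \<Phi> 0 6 1 = 0 \<and> \<Phi> 0 6 2 = 0 \<and> \<Phi> 0 6 3 = 0 \<and> \<Phi> 0 6 4 = 0 \<and>
      \<Phi> 0 6 5 = 0 \<and> \<Phi> 0 7 5 = 0 \<and> \<Phi> 1 0 0 = 0 \<and> \<Phi> 1 0 1 = 0 \<and>
      \<Phi> 1 0 2 = 0 \<and> \<Phi> 1 0 3 = 0 \<and> \<Phi> 1 0 4 = 0 \<and> \<Phi> 1 0 5 = 0 \<and>
      \<Phi> 1 1 0 = 0 \<and> \<Phi> 1 1 1 = 0 \<and> \<Phi> 1 1 2 = 0 \<and> \<Phi> 1 1 3 = 0 \<and>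
      \<Phi> 1 1 4 = 0 \<and> \<Phi> 1 1 5 = 0 \<and> \<Phi> 1 2 0 = 0 \<and> \<Phi> 1 2 1 = 0 \<and>
      \<Phi> 1 3 0 = 0 \<and> \<Phi> 1 3 1 = 0 \<and> \<Phi> 1 3 3 = 0 \<and> \<Phi> 1 4 0 = 0 \<and>
      \<Phi> 1 4 1 = 0 \<and> \<Phi> 1 4 4 = 0 \<and> \<Phi> 1 5 0 = 0 \<and> \<Phi> 1 5 1 = 0 \<and>
      \<Phi> 1 5 5 = 0 \<and> \<Phi> 1 6 0 = 0 \<and> \<Phi> 1 6 1 = 0 \<and> \<Phi> 1 7 0 = 0 \<and>
      \<Phi> 1 7 1 = 0 \<and> \<Phi> 2 0 0 = 0 \<and> \<Phi> 2 0 4 = 0 \<and> \<Phi> 2 1 1 = 0 \<and>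
      \<Phi> 2 1 4 = 0 \<and> \<Phi> 2 2 4 = 0 \<and> \<Phi> 2 3 3 = 0 \<and> \<Phi> 2 3 4 = 0 \<and>
      \<Phi> 2 4 0 = 0 \<and> \<Phi> 2 4 1 = 0 \<and> \<Phi> 2 4 2 = 0 \<and> \<Phi> 2 4 3 = 0 \<and>
      \<Phi> 2 4 4 = 0 \<and> \<Phi> 2 4 5 = 0 \<and> \<Phi> 2 5 4 = 0 \<and> \<Phi> 2 5 5 = 0 \<and>
      \<Phi> 2 6 4 = 0 \<and> \<Phi> 2 7 4 = 0"
    by (simp add: E0)
  note E1 = E0[simplified z1[unfolded One_nat_def], simplified]
  have z2:
    "\<Phi> 0 0 2 = 0 \<and> \<Phi> 0 1 4 = 0 \<and> \<Phi> 0 4 1 = 0 \<and> \<Phi> 0 4 3 = 0 \<and>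
      \<Phi> 0 7 3 = 0 \<and> \<Phi> 0 7 4 = 0 \<and> \<Phi> 1 2 2 = 0 \<and> \<Phi> 1 2 4 = 0 \<and>
      \<Phi> 1 3 4 = 0 \<and> \<Phi> 1 4 2 = 0 \<and> \<Phi> 1 4 3 = 0 \<and> \<Phi> 1 5 2 = 0 \<and>
      \<Phi> 1 6 2 = 0 \<and> \<Phi> 2 0 3 = 0 \<and> \<Phi> 2 1 2 = 0 \<and> \<Phi> 2 1 3 = 0 \<and>
      \<Phi> 2 2 0 = 0 \<and> \<Phi> 2 2 1 = 0 \<and> \<Phi> 2 3 0 = 0 \<and> \<Phi> 2 3 1 = 0 \<and>
      \<Phi> 2 3 5 = 0 \<and> \<Phi> 2 5 3 = 0 \<and> \<Phi> 2 7 5 = 0"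
    by (simp add: E1)
  note E2 = E1[simplified z2[unfolded One_nat_def], simplified]
  have z3:
    "\<Phi> 0 4 0 = 0 \<and> \<Phi> 0 7 0 = 0 \<and> \<Phi> 1 3 5 = 0 \<and> \<Phi> 1 5 3 = 0 \<and>
      \<Phi> 1 5 4 = 0 \<and> \<Phi> 1 7 2 = 0 \<and> \<Phi> 2 2 2 = 0 \<and> \<Phi> 2 7 3 = 0"
    by (simp add: E2)
  note E3 = E2[simplified z3[unfolded One_nat_def], simplified]
  have z4:
    "\<Phi> 0 0 3 = 0 \<and> \<Phi> 0 4 2 = 0 \<and> \<Phi> 0 7 2 = 0 \<and> \<Phi> 1 7 3 = 0 \<and>
      \<Phi> 2 5 1 = 0 \<and> \<Phi> 2 7 0 = 0"
    by (simp add: E3)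
  note E4 = E3[simplified z4[unfolded One_nat_def], simplified]
  have z5:
    "\<Phi> 0 0 4 = 0 \<and> \<Phi> 1 7 5 = 0 \<and> \<Phi> 2 0 1 = 0 \<and> \<Phi> 2 0 5 = 0 \<and>
      \<Phi> 2 5 2 = 0 \<and> \<Phi> 2 7 2 = 0"
    by (simp add: E4)
  note E5 = E4[simplified z5[unfolded One_nat_def], simplified]
  have z6:
    "\<Phi> 0 0 1 = 0 \<and> \<Phi> 0 3 4 = 0 \<and> \<Phi> 1 4 5 = 0 \<and> \<Phi> 2 0 2 = 0 \<and>
      \<Phi> 2 7 1 = 0"
    by (simp add: E5)
  note E6 = E5[simplified z6[unfolded One_nat_def], simplified]
  have z7:
    "\<Phi> 0 3 0 = 0 \<and> \<Phi> 0 3 1 = 0 \<and> \<Phi> 0 7 1 = 0"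
    by (simp add: E6)
  note E7 = E6[simplified z7[unfolded One_nat_def], simplified]
  have z8:
    "\<Phi> 0 2 1 = 0 \<and> \<Phi> 1 7 4 = 0 \<and> \<Phi> 2 5 0 = 0"
    by (simp add: E7)
  note E8 = E7[simplified z8[unfolded One_nat_def], simplified]
  have z9:
    "\<Phi> 0 2 2 = 0 \<and> \<Phi> 0 2 4 = 0"
    by (simp add: E8)
  note E9 = E8[simplified z9[unfolded One_nat_def], simplified]
  have z10:
    "\<Phi> 0 1 2 = 0 \<and> \<Phi> 0 2 0 = 0 \<and> \<Phi> 1 6 4 = 0"
    by (simp add: E9)
  note E10 = E9[simplified z10[unfolded One_nat_def], simplified]
  have z11:
    "\<Phi> 0 1 0 = 0 \<and> \<Phi> 0 2 3 = 0 \<and> \<Phi> 1 6 3 = 0 \<and> \<Phi> 2 6 1 = 0"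
    by (simp add: E10)
  note E11 = E10[simplified z11[unfolded One_nat_def], simplified]
  have z12:
    "\<Phi> 0 1 3 = 0 \<and> \<Phi> 2 6 2 = 0 \<and> \<Phi> 2 6 3 = 0"
    by (simp add: E11)
  note E12 = E11[simplified z12[unfolded One_nat_def], simplified]
  have z13:
    "\<Phi> 1 2 3 = 0 \<and> \<Phi> 2 1 5 = 0 \<and> \<Phi> 2 6 0 = 0 \<and> \<Phi> 2 6 5 = 0"
    by (simp add: E12)
  note E13 = E12[simplified z13[unfolded One_nat_def], simplified]
  have z14:
    "\<Phi> 2 1 0 = 0 \<and> \<Phi> 2 2 3 = 0"
    by (simp add: E13)
  note E14 = E13[simplified z14[unfolded One_nat_def], simplified]
  have z15:
    "\<Phi> 2 2 5 = 0"
    by (simp add: E14)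
  note E15 = E14[simplified z15[unfolded One_nat_def], simplified]
  have z16:
    "\<Phi> 1 2 5 = 0"
    by (simp add: E15)
  note E16 = E15[simplified z16[unfolded One_nat_def], simplified]
  have z17:
    "\<Phi> 1 6 5 = 0"
    by (simp add: E16)
  note E17 = E16[simplified z17[unfolded One_nat_def], simplified]
  \<comment> \<open>The three unknowns left are coupled, and no equation isolates one of them. The
    sum of all three vanishes, as do \<open>\<Phi> 0 3 2 + \<Phi> 1 3 2\<close> and
    \<open>\<Phi> 1 3 2 + \<Phi> 2 3 2\<close>.\<close>
  have w2: "\<Phi> 2 3 2 = 0" using E17 by (metis add_cancel_right_left)
  have w1: "\<Phi> 1 3 2 = 0" using E17(2) w2 by simp
  have w0: "\<Phi> 0 3 2 = 0" using E17(2) w1 by simp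
  note w = w0 w1[unfolded One_nat_def] w2
  note z = z1 z2 z3 z4 z5 z6 z7 z8 z9 z10 z11 z12 z13 z14 z15 z16 z17
  show ?thesis by (simp add: w z[unfolded One_nat_def])
qed

lemma enumerate_finite_type:
  obtains e :: "nat \<Rightarrow> 'a::finite" and \<iota> where "bij_betw e {..<CARD('a)} UNIV"
    "\<And>m. m < CARD('a) \<Longrightarrow> \<iota> (e m) = m"
proof -
  obtain e :: "nat \<Rightarrow> 'a" where e: "bij_betw e {..<CARD('a)} UNIV"
    using finite_same_card_bij[of "{..<CARD('a)}" "UNIV :: 'a set"] by auto
  then have "inv_into {..<CARD('a)} e (e m) = m" if "m < CARD('a)" for m
    using that by (simp add: bij_betw_def)
  then show ?thesis using e that by blast
qed

lemma border_rank_le_ten: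
  fixes T :: "3 \<Rightarrow> 8 \<Rightarrow> 6 \<Rightarrow> complex"
  shows "border_rank_le 10 T"
proof -
  obtain ea :: "nat \<Rightarrow> 3" and ia where ea: "bij_betw ea {..<3} UNIV" "\<And>m. m < 3 \<Longrightarrow> ia (ea m) = m"
    using enumerate_finite_type[where 'a = 3] by auto
  obtain eb :: "nat \<Rightarrow> 8" and ib where eb: "bij_betw eb {..<8} UNIV" "\<And>m. m < 8 \<Longrightarrow> ib (eb m) = m"
    using enumerate_finite_type[where 'a = 8] by auto
  obtain ec :: "nat \<Rightarrow> 6" and ic where ec: "bij_betw ec {..<6} UNIV" "\<And>m. m < 6 \<Longrightarrow> ic (ec m) = m"
    using enumerate_finite_type[where 'a = 6] by auto
  have sum_a: "(\<Sum>i\<in>UNIV. f i) = (\<Sum>m<3. f (ea m))" for f :: "3 \<Rightarrow> complex"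
    by (rule sum.reindex_bij_betw[OF ea(1), symmetric])
  have sum_b: "(\<Sum>i\<in>UNIV. f i) = (\<Sum>m<8. f (eb m))" for f :: "8 \<Rightarrow> complex"
    by (rule sum.reindex_bij_betw[OF eb(1), symmetric])
  have sum_c: "(\<Sum>i\<in>UNIV. f i) = (\<Sum>m<6. f (ec m))" for f :: "6 \<Rightarrow> complex"
    by (rule sum.reindex_bij_betw[OF ec(1), symmetric])
  define a where "a l i = complex_of_nat (terracini_a ! l ! ia i)" for l i
  define b where "b l i = complex_of_nat (terracini_b ! l ! ib i)" for l i
  define c where "c l i = complex_of_nat (terracini_c ! l ! ic i)" for l i
  show ?thesis
  proof (rule border_rank_le_of_tangents, rule tangents_span_everything)
    fix \<Phi> :: "3 \<Rightarrow> 8 \<Rightarrow> 6 \<Rightarrow> complex"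
    assume 1: "\<And>l i. l < 10 \<Longrightarrow> (\<Sum>j\<in>UNIV. \<Sum>k\<in>UNIV. b l j * c l k * \<Phi> i j k) = 0"
      and 2: "\<And>l j. l < 10 \<Longrightarrow> (\<Sum>i\<in>UNIV. \<Sum>k\<in>UNIV. a l i * c l k * \<Phi> i j k) = 0"
      and 3: "\<And>l k. l < 10 \<Longrightarrow> (\<Sum>i\<in>UNIV. \<Sum>j\<in>UNIV. a l i * b l j * \<Phi> i j k) = 0"
    define \<Psi> where "\<Psi> i j k = \<Phi> (ea i) (eb j) (ec k)" for i j k
    have "\<forall>i<3. \<forall>j<8. \<forall>k<6. \<Psi> i j k = 0"
    proof (rule terracini_annihilator_zero, safe)
      fix l i :: nat assume "l < 10"
      from 1[OF this, of "ea i"]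
      show "(\<Sum>j<8. \<Sum>k<6. of_nat (terracini_b ! l ! j) * of_nat (terracini_c ! l ! k) * \<Psi> i j k) = 0"
        unfolding sum_a sum_b sum_c a_def b_def c_def \<Psi>_def by (simp add: ea(2) eb(2) ec(2) cong: sum.cong_simp)
    next
      fix l j :: nat assume "l < 10"
      from 2[OF this, of "eb j"]
      show "(\<Sum>i<3. \<Sum>k<6. of_nat (terracini_a ! l ! i) * of_nat (terracini_c ! l ! k) * \<Psi> i j k) = 0"
        unfolding sum_a sum_b sum_c a_def b_def c_def \<Psi>_def by (simp add: ea(2) eb(2) ec(2) cong: sum.cong_simp)
    next
      fix l k :: nat assume "l < 10"
      from 3[OF this, of "ec k"]
      show "(\<Sum>i<3. \<Sum>j<8. of_nat (terracini_a ! l ! i) * of_nat (terracini_b ! l ! j) * \<Psi> i j k) = 0"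
        unfolding sum_a sum_b sum_c a_def b_def c_def \<Psi>_def by (simp add: ea(2) eb(2) ec(2) cong: sum.cong_simp)
    qed
    then have "\<Phi> (ea i) (eb j) (ec k) = 0" if "i < 3" "j < 8" "k < 6" for i j k
      using that by (simp add: \<Psi>_def)
    moreover have "\<exists>m<3. i = ea m" "\<exists>m<8. j = eb m" "\<exists>m<6. k = ec m" for i j k
      using ea(1) eb(1) ec(1) unfolding bij_betw_def by (metis UNIV_I imageE lessThan_iff)+
    ultimately show "\<Phi> = (\<lambda>_ _ _. 0)" by (metis (no_types, lifting) ext)
  qed
qed

section \<open>Coordinates on the Schur modules\<close>

text \<open>Row symmetry and the exchange relation between the two rows: linear equations on the
  image of \<open>young21\<close> that reduce every coordinate to eight of them.\<close>

definition schur21 :: "(3 \<times> 3 \<times> 3 \<Rightarrow> complex) \<Rightarrow> bool" where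
  "schur21 z \<longleftrightarrow> (\<forall>a b c. z (a,b,c) = z (b,a,c)) \<and> (\<forall>a b c. z (a,b,c) + z (b,c,a) + z (c,a,b) = 0)"

text \<open>The symmetric form of algebraic curvature tensors; the cyclic relation is the first
  Bianchi identity.\<close>

definition schur22 :: "(3 \<times> 3 \<times> 3 \<times> 3 \<Rightarrow> complex) \<Rightarrow> bool" where
  "schur22 z \<longleftrightarrow> (\<forall>a b c d. z (a,b,c,d) = z (b,a,c,d)) \<and> (\<forall>a b c d. z (a,b,c,d) = z (a,b,d,c)) \<and>
     (\<forall>a b c d. z (a,b,c,d) + z (b,c,a,d) + z (c,a,b,d) = 0)"

lemma schur22_young22: "schur22 (young22 x)"
  by (simp add: schur22_def young22_def row22_def col22_def)

lemma schur21_young21: "schur21 (young21 x)"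
  by (simp add: schur21_def young21_def)

lemma young22_young21_commute:
  "young22 (\<lambda>k. young21 (\<lambda>j. x j k) j) k = young21 (\<lambda>j. young22 (x j) k) j"
  by (cases j; cases k) (simp add: young22_def row22_def col22_def young21_def algebra_simps)

lemma in_schur_space_schur21: "in_schur_space T \<Longrightarrow> schur21 (\<lambda>j. T i j k)"
  by (auto simp: in_schur_space_def young22_young21_commute[of "\<lambda>j k. _ j k"] schur21_young21)

lemma in_schur_space_schur22: "in_schur_space T \<Longrightarrow> schur22 (T i j)"
  by (auto simp: in_schur_space_def schur22_young22)

text \<open>The coefficients \<open>q\<close> are uniform in \<open>z\<close>: restriction to
  \<open>K\<close> has a linear left inverse, and this linear map is what transfers border rank back
  to the ambient format.\<close>

definition determined_by :: "(('x \<Rightarrow> complex) \<Rightarrow> bool) \<Rightarrow> 'x set \<Rightarrow> 'x \<Rightarrow> bool" where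
  "determined_by V K x \<longleftrightarrow> (\<exists>q. \<forall>z. V z \<longrightarrow> z x = (\<Sum>y\<in>K. q y * z y))"

lemma determined_by_member:
  assumes "finite K" "x \<in> K"
  shows "determined_by V K x"
  unfolding determined_by_def
  using assms by (intro exI[of _ "\<lambda>y. if y = x then 1 else 0"]) (simp add: if_distrib[of "\<lambda>t. t * _"] cong: if_cong)

lemma determined_by_combination:
  assumes "\<And>z. V z \<Longrightarrow> z x = c * z y + d * z y'" "determined_by V K y" "determined_by V K y'"
  shows "determined_by V K x"
proof -
  obtain q q' where "\<And>z. V z \<Longrightarrow> z y = (\<Sum>u\<in>K. q u * z u)" "\<And>z. V z \<Longrightarrow> z y' = (\<Sum>u\<in>K. q' u * z u)"
    using assms(2,3) unfolding determined_by_def by blast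
  then have "z x = (\<Sum>u\<in>K. (c * q u + d * q' u) * z u)" if "V z" for z
    using that assms(1)[OF that] by (simp add: distrib_right sum.distrib mult.assoc flip: sum_distrib_left)
  then show ?thesis unfolding determined_by_def by (intro exI[of _ "\<lambda>u. c * q u + d * q' u"]) blast
qed

lemma determined_by_scaled:
  assumes "\<And>z. V z \<Longrightarrow> z x = c * z y" "determined_by V K y"
  shows "determined_by V K x"
  by (rule determined_by_combination[of V x c y 0 y]) (use assms in auto)

lemma determined_by_zero: "(\<And>z. V z \<Longrightarrow> z x = 0) \<Longrightarrow> determined_by V K x"
  unfolding determined_by_def by (intro exI[of _ "\<lambda>_. 0"]) simp

text \<open>One coordinate for each of the six weights with a repeated index, and two for the weight
  with indices 1, 2, 3, whose multiplicity is 2.\<close>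

definition coords21 :: "(3 \<times> 3 \<times> 3) set" where
  "coords21 = {(1,1,2), (1,1,3), (2,2,1), (2,2,3), (3,3,1), (3,3,2), (1,2,3), (2,3,1)}"

text \<open>S_(2,2) C^3 is the dual of Sym^2 C^3 twisted by the square of the determinant, so it has
  six weights, each of multiplicity one.\<close>

definition coords22 :: "(3 \<times> 3 \<times> 3 \<times> 3) set" where
  "coords22 = {(1,1,2,2), (1,1,3,3), (2,2,3,3), (1,1,2,3), (2,2,1,3), (3,3,1,2)}"

lemma finite_coords [simp]: "finite coords21" "finite coords22"
  by (simp_all add: coords21_def coords22_def)

lemma card_coords: "card coords21 = 8" "card coords22 = 6"
  by (simp_all add: coords21_def coords22_def)

lemma eq_minus_half: "x + y + y = 0 \<Longrightarrow> y = - (x / 2)" for x y :: complex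
proof -
  assume "x + y + y = 0"
  then have "x = - 2 * y" by algebra
  then show ?thesis by simp
qed

lemma schur21_determined: "determined_by schur21 coords21 j"
proof -
  let ?D = "determined_by schur21 coords21"
  have mem: "?D y" if "y \<in> coords21" for y using that by (simp add: determined_by_member)
  have aaa: "?D (a,a,a)" for a
    by (rule determined_by_zero) (auto simp: schur21_def dest!: spec[of _ a])
  have aab: "?D (a,a,b)" for a b
    using exhaust_3[of a] exhaust_3[of b] aaa mem by (auto simp: coords21_def)
  have aba: "?D (a,b,a)" for a b
  proof (rule determined_by_scaled[where c = "-1/2", OF _ aab[of a b]])
    fix z assume "schur21 z"
    then have "z (b,a,a) = z (a,b,a)" "z (a,a,b) + z (a,b,a) + z (b,a,a) = 0" unfolding schur21_def by blast+
    then show "z (a,b,a) = -1/2 * z (a,a,b)" by (simp add: eq_minus_half)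
  qed
  have swap: "?D (b,a,c)" if "?D (a,b,c)" for a b c
    by (rule determined_by_scaled[where c = 1, OF _ that]) (simp add: schur21_def)
  have "?D (3,1,2)"
    by (rule determined_by_combination[where c = "-1" and d = "-1", OF _ mem[of "(1,2,3)"] mem[of "(2,3,1)"]])
      (auto simp: schur21_def coords21_def eq_neg_iff_add_eq_0 algebra_simps)
  then have "?D (a,b,c)" for a b c
    using exhaust_3[of a] exhaust_3[of b] exhaust_3[of c] aab aba swap[OF aba] swap mem
    by (auto simp: coords21_def)
  then show ?thesis by (cases j) auto
qed

text \<open>As for the Riemann curvature tensor: four instances of the Bianchi identity, combined
  with the symmetries inside the pairs, give the exchange of the pairs.\<close>

lemma schur22_pair_symmetry:
  assumes "schur22 z"
  shows "z (c,d,a,b) = z (a,b,c,d)"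
proof -
  have s: "z (p,q,r,t) = z (q,p,r,t)" "z (p,q,r,t) = z (p,q,t,r)"
    "z (p,q,r,t) + z (q,r,p,t) + z (r,p,q,t) = 0" for p q r t
    using assms unfolding schur22_def by blast+
  have "z (c,d,a,b) + z (d,a,b,c) + z (c,a,b,d) = 0" "z (c,d,a,b) + z (b,d,a,c) + z (b,c,a,d) = 0"
    using s(3)[of c d a b] s(3)[of c d b a] s(1)[of a c d b] s(2)[of c a d b] s(2)[of d a c b]
      s(1)[of d b c a] s(2)[of b d c a] s(2)[of b c d a] s(2)[of c d b a] by simp_all
  then show ?thesis using s(3)[of a b c d] s(3)[of a b d c] s(2)[of a b d c] by algebra
qed

lemma schur22_determined: "determined_by schur22 coords22 k"
proof -
  let ?D = "determined_by schur22 coords22"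
  have mem: "?D y" if "y \<in> coords22" for y using that by (simp add: determined_by_member)
  have aaad: "z (a,a,a,d) = 0" if "schur22 z" for z a d
  proof -
    have "z (a,a,a,d) + z (a,a,a,d) + z (a,a,a,d) = 0" using that unfolding schur22_def by blast
    then show ?thesis by simp
  qed
  have pair: "?D (c,d,a,b)" if "?D (a,b,c,d)" for a b c d
    by (rule determined_by_scaled[where c = 1, OF _ that]) (simp add: schur22_pair_symmetry)
  have swap: "?D (b,a,c,d)" if "?D (a,b,c,d)" for a b c d
    by (rule determined_by_scaled[where c = 1, OF _ that]) (simp add: schur22_def)
  have swap': "?D (a,b,d,c)" if "?D (a,b,c,d)" for a b c d
    by (rule determined_by_scaled[where c = 1, OF _ that]) (simp add: schur22_def)
  have aaad': "?D (a,a,a,d)" for a d by (rule determined_by_zero) (rule aaad)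
  have aacd: "?D (a,a,c,d)" for a c d
    using exhaust_3[of a] exhaust_3[of c] exhaust_3[of d] aaad' swap'[OF aaad'] mem swap'[OF mem] pair[OF mem]
    by (auto simp: coords22_def)
  have abad: "?D (a,b,a,d)" for a b d
  proof (rule determined_by_scaled[where c = "-1/2", OF _ aacd[of a b d]])
    fix z assume "schur22 z"
    then have "z (b,a,a,d) = z (a,b,a,d)" "z (a,a,b,d) + z (a,b,a,d) + z (b,a,a,d) = 0"
      unfolding schur22_def by blast+
    then show "z (a,b,a,d) = -1/2 * z (a,a,b,d)" by (simp add: eq_minus_half)
  qed
  have "?D (a,b,c,d)" for a b c d
  proof -
    \<comment> \<open>Four indices with three possible values cannot be distinct, and the symmetries
      bring any coincidence into the form \<open>(a,a,c,d)\<close> or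
      \<open>(a,b,a,d)\<close>.\<close>
    have "a = b \<or> c = d \<or> a = c \<or> a = d \<or> b = c \<or> b = d"
      using exhaust_3[of a] exhaust_3[of b] exhaust_3[of c] exhaust_3[of d] by auto
    then show ?thesis using aacd abad pair swap swap' by metis
  qed
  then show ?thesis by (cases k) auto
qed

section \<open>The invariant tensor\<close>

text \<open>The same matrix acts in every position, so the action commutes with permuting positions.
  The last permutation is a 3-cycle, hence its reindexing has different maps in the two
  directions.\<close>

lemma sum_coef3_young21:
  "(\<Sum>j'\<in>UNIV. coef3 h j' j * young21 x j') = young21 (\<lambda>j. \<Sum>j'\<in>UNIV. coef3 h j' j * x j') j"
proof -
  obtain a b c where j: "j = (a, b, c)" by (cases j) auto
  let ?F = "\<lambda>j. \<Sum>j'\<in>UNIV. coef3 h j' j * x j'"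
  have 1: "(\<Sum>j'\<in>UNIV. coef3 h j' (a,b,c) * (case j' of (p,q,r) \<Rightarrow> x (q,p,r))) = ?F (b,a,c)"
    by (rule sum.reindex_bij_witness[of _ "\<lambda>(p,q,r). (q,p,r)" "\<lambda>(p,q,r). (q,p,r)"])
      (auto simp: coef3_def)
  have 2: "(\<Sum>j'\<in>UNIV. coef3 h j' (a,b,c) * (case j' of (p,q,r) \<Rightarrow> x (r,q,p))) = ?F (c,b,a)"
    by (rule sum.reindex_bij_witness[of _ "\<lambda>(p,q,r). (r,q,p)" "\<lambda>(p,q,r). (r,q,p)"])
      (auto simp: coef3_def)
  have 3: "(\<Sum>j'\<in>UNIV. coef3 h j' (a,b,c) * (case j' of (p,q,r) \<Rightarrow> x (r,p,q))) = ?F (c,a,b)"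
    by (rule sum.reindex_bij_witness[of _ "\<lambda>(p,q,r). (q,r,p)" "\<lambda>(p,q,r). (r,p,q)"])
      (auto simp: coef3_def)
  have "(\<Sum>j'\<in>UNIV. coef3 h j' j * young21 x j')
      = ?F (a,b,c) + (\<Sum>j'\<in>UNIV. coef3 h j' (a,b,c) * (case j' of (p,q,r) \<Rightarrow> x (q,p,r)))
      - (\<Sum>j'\<in>UNIV. coef3 h j' (a,b,c) * (case j' of (p,q,r) \<Rightarrow> x (r,q,p)))
      - (\<Sum>j'\<in>UNIV. coef3 h j' (a,b,c) * (case j' of (p,q,r) \<Rightarrow> x (r,p,q)))"
    unfolding sum_subtractf[symmetric] sum.distrib[symmetric] j
    by (intro sum.cong) (auto simp: young21_def algebra_simps)
  then show ?thesis unfolding 1 2 3 by (simp add: young21_def j)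
qed

lemma sum_coef4_row22:
  "(\<Sum>k'\<in>UNIV. coef4 g k k' * row22 x k') = row22 (\<lambda>k. \<Sum>k'\<in>UNIV. coef4 g k k' * x k') k"
proof -
  obtain a b c d where k: "k = (a, b, c, d)" by (cases k) auto
  let ?F = "\<lambda>k. \<Sum>k'\<in>UNIV. coef4 g k k' * x k'"
  have 1: "(\<Sum>k'\<in>UNIV. coef4 g (a,b,c,d) k' * (case k' of (p,q,r,t) \<Rightarrow> x (q,p,r,t))) = ?F (b,a,c,d)"
    by (rule sum.reindex_bij_witness[of _ "\<lambda>(p,q,r,t). (q,p,r,t)" "\<lambda>(p,q,r,t). (q,p,r,t)"])
      (auto simp: coef4_def)
  have 2: "(\<Sum>k'\<in>UNIV. coef4 g (a,b,c,d) k' * (case k' of (p,q,r,t) \<Rightarrow> x (p,q,t,r))) = ?F (a,b,d,c)"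
    by (rule sum.reindex_bij_witness[of _ "\<lambda>(p,q,r,t). (p,q,t,r)" "\<lambda>(p,q,r,t). (p,q,t,r)"])
      (auto simp: coef4_def)
  have 3: "(\<Sum>k'\<in>UNIV. coef4 g (a,b,c,d) k' * (case k' of (p,q,r,t) \<Rightarrow> x (q,p,t,r))) = ?F (b,a,d,c)"
    by (rule sum.reindex_bij_witness[of _ "\<lambda>(p,q,r,t). (q,p,t,r)" "\<lambda>(p,q,r,t). (q,p,t,r)"])
      (auto simp: coef4_def)
  have "(\<Sum>k'\<in>UNIV. coef4 g k k' * row22 x k')
      = ?F (a,b,c,d) + (\<Sum>k'\<in>UNIV. coef4 g (a,b,c,d) k' * (case k' of (p,q,r,t) \<Rightarrow> x (q,p,r,t)))
      + (\<Sum>k'\<in>UNIV. coef4 g (a,b,c,d) k' * (case k' of (p,q,r,t) \<Rightarrow> x (p,q,t,r)))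
      + (\<Sum>k'\<in>UNIV. coef4 g (a,b,c,d) k' * (case k' of (p,q,r,t) \<Rightarrow> x (q,p,t,r)))"
    unfolding sum_subtractf[symmetric] sum.distrib[symmetric] k
    by (intro sum.cong) (auto simp: row22_def algebra_simps)
  then show ?thesis unfolding 1 2 3 by (simp add: row22_def k)
qed

lemma sum_coef4_col22:
  "(\<Sum>k'\<in>UNIV. coef4 g k k' * col22 x k') = col22 (\<lambda>k. \<Sum>k'\<in>UNIV. coef4 g k k' * x k') k"
proof -
  obtain a b c d where k: "k = (a, b, c, d)" by (cases k) auto
  let ?F = "\<lambda>k. \<Sum>k'\<in>UNIV. coef4 g k k' * x k'"
  have 1: "(\<Sum>k'\<in>UNIV. coef4 g (a,b,c,d) k' * (case k' of (p,q,r,t) \<Rightarrow> x (r,q,p,t))) = ?F (c,b,a,d)"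
    by (rule sum.reindex_bij_witness[of _ "\<lambda>(p,q,r,t). (r,q,p,t)" "\<lambda>(p,q,r,t). (r,q,p,t)"])
      (auto simp: coef4_def)
  have 2: "(\<Sum>k'\<in>UNIV. coef4 g (a,b,c,d) k' * (case k' of (p,q,r,t) \<Rightarrow> x (p,t,r,q))) = ?F (a,d,c,b)"
    by (rule sum.reindex_bij_witness[of _ "\<lambda>(p,q,r,t). (p,t,r,q)" "\<lambda>(p,q,r,t). (p,t,r,q)"])
      (auto simp: coef4_def)
  have 3: "(\<Sum>k'\<in>UNIV. coef4 g (a,b,c,d) k' * (case k' of (p,q,r,t) \<Rightarrow> x (r,t,p,q))) = ?F (c,d,a,b)"
    by (rule sum.reindex_bij_witness[of _ "\<lambda>(p,q,r,t). (r,t,p,q)" "\<lambda>(p,q,r,t). (r,t,p,q)"])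
      (auto simp: coef4_def)
  have "(\<Sum>k'\<in>UNIV. coef4 g k k' * col22 x k')
      = ?F (a,b,c,d) - (\<Sum>k'\<in>UNIV. coef4 g (a,b,c,d) k' * (case k' of (p,q,r,t) \<Rightarrow> x (r,q,p,t)))
      - (\<Sum>k'\<in>UNIV. coef4 g (a,b,c,d) k' * (case k' of (p,q,r,t) \<Rightarrow> x (p,t,r,q)))
      + (\<Sum>k'\<in>UNIV. coef4 g (a,b,c,d) k' * (case k' of (p,q,r,t) \<Rightarrow> x (r,t,p,q)))"
    unfolding sum_subtractf[symmetric] sum.distrib[symmetric] k
    by (intro sum.cong) (auto simp: col22_def algebra_simps)
  then show ?thesis unfolding 1 2 3 by (simp add: col22_def k)
qed

lemma sum_coef4_young22:
  "(\<Sum>k'\<in>UNIV. coef4 g k k' * young22 x k') = young22 (\<lambda>k. \<Sum>k'\<in>UNIV. coef4 g k k' * x k') k"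
  unfolding young22_def sum_coef4_row22 sum_coef4_col22 ..

lemma sum_young22: "(\<Sum>i\<in>I. c i * young22 (x i) k) = young22 (\<lambda>k. \<Sum>i\<in>I. c i * x i k) k"
  by (cases k) (simp add: young22_def row22_def col22_def algebra_simps sum.distrib sum_subtractf)

lemma sum_young21: "(\<Sum>i\<in>I. c i * young21 (x i) j) = young21 (\<lambda>j. \<Sum>i\<in>I. c i * x i j) j"
  by (cases j) (simp add: young21_def algebra_simps sum.distrib sum_subtractf)

section \<open>Construction of the invariant tensor\<close>

lemma sum_UNIV_3_3_3: "(\<Sum>j\<in>UNIV. f j) = (\<Sum>a\<in>UNIV. \<Sum>b\<in>UNIV. \<Sum>c\<in>UNIV. f (a, b, c))"
  for f :: "3 \<times> 3 \<times> 3 \<Rightarrow> complex"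
  by (simp add: sum.cartesian_product UNIV_Times_UNIV)

lemma sum_UNIV_3_3_3_3: "(\<Sum>j\<in>UNIV. f j) = (\<Sum>a\<in>UNIV. \<Sum>b\<in>UNIV. \<Sum>c\<in>UNIV. \<Sum>d\<in>UNIV. f (a, b, c, d))"
  for f :: "3 \<times> 3 \<times> 3 \<times> 3 \<Rightarrow> complex"
  by (simp add: sum.cartesian_product UNIV_Times_UNIV)

text \<open>The identity of the fourth tensor power of C^3 as an element of its dual tensored with
  itself; the dual factor of the last position is split off as \<open>i\<close>.\<close>

definition identity_tensor :: amb_tensor where
  "identity_tensor = (\<lambda>i (a,b,c) k. if k = (a,b,c,i) then 1 else 0)"

text \<open>Young symmetrizers commute with the group, so they turn one invariant into another. By
  Pieri's rule S_(2,2) occurs once in S_(2,1) \<otimes> C^3; that the symmetrizers do not kill the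
  canonical tensor is checked on a single coordinate.\<close>

definition pieri_tensor :: amb_tensor where
  "pieri_tensor = (\<lambda>i j k. young22 (\<lambda>k'. young21 (\<lambda>j'. identity_tensor i j' k') j) k)"

lemma gl3_act_nested:
  "gl3_act g T i j k = (\<Sum>i'\<in>UNIV. matrix_inv g $ i' $ i *
     (\<Sum>j'\<in>UNIV. coef3 (matrix_inv g) j' j * (\<Sum>k'\<in>UNIV. coef4 g k k' * T i' j' k')))"
  by (simp add: gl3_act_def Let_def sum_distrib_left mult.assoc)

lemma gl3_act_young:
  "gl3_act g (\<lambda>i j k. young22 (\<lambda>k'. young21 (\<lambda>j'. S i j' k') j) k)
   = (\<lambda>i j k. young22 (\<lambda>k'. young21 (\<lambda>j'. gl3_act g S i j' k') j) k)"
  unfolding gl3_act_nested fun_eq_iff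
  by (simp add: sum_coef4_young22 sum_young21 sum_coef3_young21 sum_young22 young22_young21_commute)

text \<open>Each of the four paired positions contributes an entry of
  \<open>g ** matrix_inv g\<close>, so the fourfold sum factors into Kronecker deltas.\<close>

lemma gl3_invariant_identity_tensor: "gl3_invariant identity_tensor"
  unfolding gl3_invariant_def
proof (intro allI impI ext)
  fix g :: "complex^3^3" and i :: 3 and j :: "3 \<times> 3 \<times> 3" and k :: "3 \<times> 3 \<times> 3 \<times> 3"
  assume g: "invertible g"
  define h where "h = matrix_inv g"
  obtain a b c where j: "j = (a, b, c)" by (cases j) auto
  obtain p q r t where k: "k = (p, q, r, t)" by (cases k) auto
  have gh: "(\<Sum>y\<in>UNIV. g$x$y * h$y$z) = (if x = z then 1 else 0)" for x z
    using arg_cong[OF matrix_mul_matrix_inv[OF g], of "\<lambda>m. m$x$z"]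
    by (simp add: matrix_matrix_mult_def mat_def h_def)
  have "(\<Sum>k'\<in>UNIV. coef4 g k k' * identity_tensor i' j' k') = coef4 g k (fst j', fst (snd j'), snd (snd j'), i')"
    for i' j'
    by (cases j') (simp add: identity_tensor_def if_distrib[of "\<lambda>u. _ * u"] cong: if_cong)
  then have "gl3_act g identity_tensor i j k
      = (\<Sum>i'\<in>UNIV. h$i'$i * (\<Sum>a'\<in>UNIV. \<Sum>b'\<in>UNIV. \<Sum>c'\<in>UNIV.
          h$a'$a * h$b'$b * h$c'$c * (g$p$a' * g$q$b' * g$r$c' * g$t$i')))"
    by (simp add: gl3_act_nested h_def j k sum_UNIV_3_3_3 coef3_def coef4_def)
  also have "\<dots> = (\<Sum>i'\<in>UNIV. \<Sum>a'\<in>UNIV. \<Sum>b'\<in>UNIV. \<Sum>c'\<in>UNIV.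
      (g$t$i' * h$i'$i) * ((g$p$a' * h$a'$a) * ((g$q$b' * h$b'$b) * (g$r$c' * h$c'$c))))"
    by (simp only: sum_distrib_left mult_ac)
  also have "\<dots> = (\<Sum>i'\<in>UNIV. g$t$i' * h$i'$i) * ((\<Sum>a'\<in>UNIV. g$p$a' * h$a'$a) *
      ((\<Sum>b'\<in>UNIV. g$q$b' * h$b'$b) * (\<Sum>c'\<in>UNIV. g$r$c' * h$c'$c)))"
    by (simp only: sum_distrib_left[symmetric] sum_distrib_right[symmetric])
  also have "\<dots> = identity_tensor i j k"
    unfolding gh by (auto simp: identity_tensor_def j k)
  finally show "gl3_act g identity_tensor i j k = identity_tensor i j k" .
qed

lemma gl3_invariant_pieri_tensor: "gl3_invariant pieri_tensor"
  using gl3_invariant_identity_tensor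
  unfolding gl3_invariant_def pieri_tensor_def gl3_act_young by simp

lemma in_schur_space_pieri_tensor: "in_schur_space pieri_tensor"
  unfolding in_schur_space_def pieri_tensor_def by blast

text \<open>Moving the inverse matrices to the other side makes both sides polynomial in the entries
  of \<open>g\<close>, so that the relation can be differentiated without differentiating a matrix
  inverse.\<close>

lemma gl3_invariant_intertwines:
  assumes "gl3_invariant T" "invertible g"
  shows "(\<Sum>k'\<in>UNIV. coef4 g k k' * T i j k')
    = (\<Sum>i'\<in>UNIV. \<Sum>j'\<in>UNIV. g$i'$i * coef3 g j' j * T i' j' k)"
proof -
  define h where "h = matrix_inv g"
  define X where "X i j = (\<Sum>k'\<in>UNIV. coef4 g k k' * T i j k')" for i j
  have hg: "(\<Sum>y\<in>UNIV. h$x$y * g$y$z) = (if x = z then 1 else 0)" for x z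
    using arg_cong[OF matrix_inv_matrix_mul[OF assms(2)], of "\<lambda>m. m$x$z"]
    by (simp add: matrix_matrix_mult_def mat_def h_def)
  have hg3: "(\<Sum>j'\<in>UNIV. coef3 h j'' j' * coef3 g j' j) = (if j'' = j then 1 else 0)" for j'' j
  proof -
    obtain a b c p q r where "j = (a, b, c)" "j'' = (p, q, r)" by (cases j; cases j'') auto
    then have "(\<Sum>j'\<in>UNIV. coef3 h j'' j' * coef3 g j' j) = (\<Sum>a'\<in>UNIV. \<Sum>b'\<in>UNIV. \<Sum>c'\<in>UNIV.
        (h$p$a' * g$a'$a) * ((h$q$b' * g$b'$b) * (h$r$c' * g$c'$c)))"
      by (simp only: sum_UNIV_3_3_3 coef3_def prod.case mult_ac)
    also have "\<dots> = (\<Sum>a'\<in>UNIV. h$p$a' * g$a'$a) *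
        ((\<Sum>b'\<in>UNIV. h$q$b' * g$b'$b) * (\<Sum>c'\<in>UNIV. h$r$c' * g$c'$c))"
      by (simp only: sum_distrib_left[symmetric] sum_distrib_right[symmetric])
    also have "\<dots> = (if j'' = j then 1 else 0)"
      unfolding hg using \<open>j = _\<close> \<open>j'' = _\<close> by simp
    finally show ?thesis .
  qed
  have T: "T i' j' k = (\<Sum>i''\<in>UNIV. \<Sum>j''\<in>UNIV. h$i''$i' * coef3 h j'' j' * X i'' j'')" for i' j'
  proof -
    have "T i' j' k = gl3_act g T i' j' k" using assms by (simp add: gl3_invariant_def)
    then show ?thesis by (simp add: gl3_act_nested h_def X_def sum_distrib_left mult.assoc)
  qed
  have "(\<Sum>i'\<in>UNIV. \<Sum>j'\<in>UNIV. g$i'$i * coef3 g j' j * T i' j' k)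
      = (\<Sum>i'\<in>UNIV. \<Sum>j'\<in>UNIV. \<Sum>i''\<in>UNIV. \<Sum>j''\<in>UNIV.
          (h$i''$i' * g$i'$i) * ((coef3 h j'' j' * coef3 g j' j) * X i'' j''))"
    unfolding T sum_distrib_left by (simp only: mult_ac)
  also have "\<dots> = (\<Sum>i'\<in>UNIV. \<Sum>i''\<in>UNIV. \<Sum>j'\<in>UNIV. \<Sum>j''\<in>UNIV.
          (h$i''$i' * g$i'$i) * ((coef3 h j'' j' * coef3 g j' j) * X i'' j''))"
    by (intro sum.cong refl sum.swap)
  also have "\<dots> = (\<Sum>i''\<in>UNIV. \<Sum>i'\<in>UNIV. \<Sum>j''\<in>UNIV. \<Sum>j'\<in>UNIV.
          (h$i''$i' * g$i'$i) * ((coef3 h j'' j' * coef3 g j' j) * X i'' j''))"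
    by (subst sum.swap) (intro sum.cong refl sum.swap)
  also have "\<dots> = (\<Sum>i''\<in>UNIV. (\<Sum>i'\<in>UNIV. h$i''$i' * g$i'$i) *
      (\<Sum>j''\<in>UNIV. (\<Sum>j'\<in>UNIV. coef3 h j'' j' * coef3 g j' j) * X i'' j''))"
    by (simp only: sum_distrib_left[symmetric] sum_distrib_right[symmetric])
  also have "\<dots> = X i j"
    unfolding hg hg3 by (simp add: if_distrib[of "\<lambda>u. u * _"] cong: if_cong)
  finally show ?thesis by (simp add: X_def)
qed

text \<open>The derivative of the intertwining relation at s = 0 for g = 1 + s E(p,q).\<close>

lemma gl3_invariant_lie_relation:
  assumes "gl3_invariant T"
  shows "(if a = p then T i (x,y,z) (q,b,c,d) else 0) + (if b = p then T i (x,y,z) (a,q,c,d) else 0)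
       + (if c = p then T i (x,y,z) (a,b,q,d) else 0) + (if d = p then T i (x,y,z) (a,b,c,q) else 0)
     = (if i = q then T p (x,y,z) (a,b,c,d) else 0) + (if x = q then T i (p,y,z) (a,b,c,d) else 0)
       + (if y = q then T i (x,p,z) (a,b,c,d) else 0) + (if z = q then T i (x,y,p) (a,b,c,d) else 0)"
    (is "?L = ?R")
proof -
  define e where "e u v = (if u = p \<and> v = q then 1 else (0::complex))" for u v :: 3
  define \<delta> where "\<delta> u v = (if u = v then 1 else (0::complex))" for u v :: 3
  have sum_e: "(\<Sum>v\<in>UNIV. e u v * f v) = (if u = p then f q else 0)"
    and sum_e': "(\<Sum>v\<in>UNIV. e v u * f v) = (if u = q then f p else 0)" for u and f :: "3 \<Rightarrow> complex"
    by (simp_all add: e_def if_distrib[of "\<lambda>u. u * _"] cong: if_cong)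
  have sum_\<delta>: "(\<Sum>v\<in>UNIV. \<delta> u v * f v) = f u"
    and sum_\<delta>': "(\<Sum>v\<in>UNIV. \<delta> v u * f v) = f u" for u and f :: "3 \<Rightarrow> complex"
    by (simp_all add: \<delta>_def if_distrib[of "\<lambda>u. u * _"] cong: if_cong)
  define G where "G s = (\<chi> u v. \<delta> u v + s * e u v)" for s
  have G: "G s $ u $ v = \<delta> u v + s * e u v" for s u v by (simp add: G_def)
  have G0: "G 0 = mat 1" by (simp add: G_def \<delta>_def mat_def)
  have cont: "continuous_on UNIV (\<lambda>s. det (G s))"
    unfolding det_def G by (intro continuous_intros)
  \<comment> \<open>The intertwining relation holds where \<open>G s\<close> is invertible. This
    includes a neighbourhood of 0, enough to equate the derivatives there.\<close>
  have "eventually (\<lambda>s. det (G s) \<noteq> 0) (nhds 0)"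
    unfolding eventually_nhds
    using open_vimage[OF open_Compl[OF closed_singleton[of 0]] cont] G0
    by (intro exI[of _ "(\<lambda>s. det (G s)) -` (- {0})"]) auto
  then have ev: "eventually (\<lambda>s. (\<Sum>k'\<in>UNIV. coef4 (G s) (a,b,c,d) k' * T i (x,y,z) k')
      = (\<Sum>i'\<in>UNIV. \<Sum>j'\<in>UNIV. G s $ i' $ i * coef3 (G s) j' (x,y,z) * T i' j' (a,b,c,d))) (nhds 0)"
    by (rule eventually_mono) (simp add: gl3_invariant_intertwines[OF assms] invertible_det_nz)
  have L: "((\<lambda>s. \<Sum>k'\<in>UNIV. coef4 (G s) (a,b,c,d) k' * T i (x,y,z) k') has_field_derivative ?L) (at 0)"
  proof -
    have "((\<lambda>s. coef4 (G s) (a,b,c,d) (a',b',c',d')) has_field_derivative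
        (e a a' * \<delta> b b' * \<delta> c c' * \<delta> d d' + \<delta> a a' * e b b' * \<delta> c c' * \<delta> d d'
         + \<delta> a a' * \<delta> b b' * e c c' * \<delta> d d' + \<delta> a a' * \<delta> b b' * \<delta> c c' * e d d')) (at 0)" for a' b' c' d'
      unfolding coef4_def prod.case G by (auto intro!: derivative_eq_intros simp: algebra_simps)
    then have "((\<lambda>s. \<Sum>k'\<in>UNIV. coef4 (G s) (a,b,c,d) k' * T i (x,y,z) k') has_field_derivative
      (\<Sum>a'\<in>UNIV. \<Sum>b'\<in>UNIV. \<Sum>c'\<in>UNIV. \<Sum>d'\<in>UNIV.
        (e a a' * \<delta> b b' * \<delta> c c' * \<delta> d d' + \<delta> a a' * e b b' * \<delta> c c' * \<delta> d d'
         + \<delta> a a' * \<delta> b b' * e c c' * \<delta> d d' + \<delta> a a' * \<delta> b b' * \<delta> c c' * e d d')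
        * T i (x,y,z) (a',b',c',d'))) (at 0)"
      unfolding sum_UNIV_3_3_3_3 by (intro DERIV_sum DERIV_cmult_right)
    also have "(\<Sum>a'\<in>UNIV. \<Sum>b'\<in>UNIV. \<Sum>c'\<in>UNIV. \<Sum>d'\<in>UNIV.
        (e a a' * \<delta> b b' * \<delta> c c' * \<delta> d d' + \<delta> a a' * e b b' * \<delta> c c' * \<delta> d d'
         + \<delta> a a' * \<delta> b b' * e c c' * \<delta> d d' + \<delta> a a' * \<delta> b b' * \<delta> c c' * e d d')
        * T i (x,y,z) (a',b',c',d')) = ?L"
      by (simp add: distrib_right sum.distrib mult.assoc sum_\<delta> sum_e flip: sum_distrib_left)
    finally show ?thesis .
  qed
  have R: "((\<lambda>s. \<Sum>i'\<in>UNIV. \<Sum>j'\<in>UNIV. G s $ i' $ i * coef3 (G s) j' (x,y,z) * T i' j' (a,b,c,d))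
      has_field_derivative ?R) (at 0)"
  proof -
    have "((\<lambda>s. G s $ i' $ i * coef3 (G s) (x',y',z') (x,y,z)) has_field_derivative
        (e i' i * \<delta> x' x * \<delta> y' y * \<delta> z' z + \<delta> i' i * e x' x * \<delta> y' y * \<delta> z' z
         + \<delta> i' i * \<delta> x' x * e y' y * \<delta> z' z + \<delta> i' i * \<delta> x' x * \<delta> y' y * e z' z)) (at 0)" for i' x' y' z'
      unfolding coef3_def prod.case G by (auto intro!: derivative_eq_intros simp: algebra_simps)
    then have "((\<lambda>s. \<Sum>i'\<in>UNIV. \<Sum>j'\<in>UNIV. G s $ i' $ i * coef3 (G s) j' (x,y,z) * T i' j' (a,b,c,d))
      has_field_derivative
      (\<Sum>i'\<in>UNIV. \<Sum>x'\<in>UNIV. \<Sum>y'\<in>UNIV. \<Sum>z'\<in>UNIV.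
        (e i' i * \<delta> x' x * \<delta> y' y * \<delta> z' z + \<delta> i' i * e x' x * \<delta> y' y * \<delta> z' z
         + \<delta> i' i * \<delta> x' x * e y' y * \<delta> z' z + \<delta> i' i * \<delta> x' x * \<delta> y' y * e z' z)
        * T i' (x',y',z') (a,b,c,d))) (at 0)"
      unfolding sum_UNIV_3_3_3 by (intro DERIV_sum DERIV_cmult_right)
    also have "(\<Sum>i'\<in>UNIV. \<Sum>x'\<in>UNIV. \<Sum>y'\<in>UNIV. \<Sum>z'\<in>UNIV.
        (e i' i * \<delta> x' x * \<delta> y' y * \<delta> z' z + \<delta> i' i * e x' x * \<delta> y' y * \<delta> z' z
         + \<delta> i' i * \<delta> x' x * e y' y * \<delta> z' z + \<delta> i' i * \<delta> x' x * \<delta> y' y * e z' z)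
        * T i' (x',y',z') (a,b,c,d)) = ?R"
      by (simp add: distrib_right sum.distrib mult.assoc sum_\<delta>' sum_e' flip: sum_distrib_left)
    finally show ?thesis .
  qed
  show ?thesis
    using L DERIV_cong_ev[OF refl ev refl] R DERIV_unique by blast
qed

section \<open>Uniqueness and border rank of the invariant tensor\<close>

lemma determined_by_zero_coords:
  assumes "\<And>x. determined_by V K x" "V z" "\<And>y. y \<in> K \<Longrightarrow> z y = 0"
  shows "z x = 0"
proof -
  obtain q where "\<And>z. V z \<Longrightarrow> z x = (\<Sum>y\<in>K. q y * z y)"
    using assms(1)[of x] unfolding determined_by_def by blast
  then have "z x = (\<Sum>y\<in>K. q y * z y)" using assms(2) by blast
  also have "\<dots> = 0" by (intro sum.neutral) (simp add: assms(3))
  finally show ?thesis .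
qed

lemma schur22_triple_zero:
  assumes "schur22 z"
  shows "z (a,b,b,b) = 0" "z (b,a,b,b) = 0"
proof -
  have "z (b,b,b,a) + z (b,b,b,a) + z (b,b,b,a) = 0" using assms unfolding schur22_def by blast
  then have "z (b,b,b,a) = 0" by simp
  moreover have "z (b,b,a,b) = z (b,b,b,a)" using assms unfolding schur22_def by blast
  ultimately show "z (a,b,b,b) = 0" using schur22_pair_symmetry[OF assms, of a b b b] by simp
  moreover have "z (b,a,b,b) = z (a,b,b,b)" using assms unfolding schur22_def by blast
  ultimately show "z (b,a,b,b) = 0" by simp
qed

text \<open>The value on the highest weight vector determines the other values at (1,1,2,2), and lowering
  operators reach all other weights.\<close>

lemma invariant_zero_if_highest_coordinate_zero:
  assumes S: "in_schur_space T" and inv: "gl3_invariant T" and zero: "T 1 (2,2,1) (1,1,2,2) = 0"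
  shows "T = (\<lambda>_ _ _. 0)"
proof -
  note lie = gl3_invariant_lie_relation[OF inv]
  have s21: "schur21 (\<lambda>j. T i j k)" for i k using S by (rule in_schur_space_schur21)
  have s22: "schur22 (T i j)" for i j using S by (rule in_schur_space_schur22)
  have sym: "T i j (b,a,c,d) = T i j (a,b,c,d)" "T i j (a,b,d,c) = T i j (a,b,c,d)" for i j a b c d
    using s22[of i j] unfolding schur22_def by blast+
  have bianchi: "T i j (a,b,c,d) + T i j (b,c,a,d) + T i j (c,a,b,d) = 0" for i j a b c d
    using s22[of i j] unfolding schur22_def by blast
  have sym21: "T i (b,a,c) k = T i (a,b,c) k" and
    cyc21: "T i (a,b,c) k + T i (b,c,a) k + T i (c,a,b) k = 0" for i a b c k
    using s21[of i k] unfolding schur21_def by blast+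
  \<comment> \<open>The relation for E(1,2): on its left side the quadruple (1,1,2,2) turns into
    quadruples with three indices 2, where \<open>T\<close> vanishes.\<close>
  have "T 1 (2,2,1) (1,1,2,2) + T 2 (1,2,1) (1,1,2,2) + T 2 (2,1,1) (1,1,2,2) = 0"
    using lie[of 1 1 2 "2" 2 1 2 1 2 2] schur22_triple_zero[OF s22] by simp
  then have T2: "T 2 (1,1,2) (1,1,2,2) = 0"
    using cyc21[of 2 1 1 2 "(1,1,2,2)"] zero by (simp add: add.assoc)
  \<comment> \<open>The relations with p = q compare weights: an entry at (1,1,2,2) vanishes unless
    1 and 2 each occur twice among \<open>i\<close>, \<open>u\<close>, \<open>v\<close>,
    \<open>w\<close>. Within \<open>coords21\<close> this leaves only the two entries already
    treated.\<close>
  have top: "T i j (1,1,2,2) = 0" for i j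
  proof (rule determined_by_zero_coords[OF schur21_determined s21])
    fix y assume y: "y \<in> coords21"
    obtain u v w where uvw: "y = (u, v, w)" by (cases y) auto
    show "T i y (1,1,2,2) = 0"
      using y zero T2 exhaust_3[of i] lie[of 1 1 i u v w 1 1 2 2] lie[of 1 2 i u v w 2 1 2 2]
        lie[of 1 3 i u v w 3 1 2 2]
      unfolding uvw coords21_def by auto
  qed
  \<comment> \<open>The right side of a Lie relation involves only values at the quadruple
    (a,b,c,d). When these all vanish, so does the left side, which lives on another weight if p and
    q differ.\<close>
  have lower: "(if a = p then T i j (q,b,c,d) else 0) + (if b = p then T i j (a,q,c,d) else 0)
       + (if c = p then T i j (a,b,q,d) else 0) + (if d = p then T i j (a,b,c,q) else 0) = 0"
    if "\<And>i j. T i j (a,b,c,d) = 0" for a b c d p q i j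
  proof -
    obtain x y z where "j = (x, y, z)" by (cases j) auto
    then show ?thesis
      using lie[of a p i x y z q b c d] unfolding that if_cancel add_0_left by (simp only:)
  qed
  have 1123: "T i j (1,1,2,3) = 0" for i j
    using lower[OF top, of 2 i j 3] sym(2)[of i j 1 1 2 3] by simp
  have 1133: "T i j (1,1,3,3) = 0" for i j
    using lower[OF 1123, of 2 i j 3] by simp
  have 1223: "T i j (1,2,2,3) = 0" for i j
    using lower[OF 1123, of 1 i j 2] sym(1)[of i j 1 2 2 3] by simp
  have 2213: "T i j (2,2,1,3) = 0" for i j
    using bianchi[of i j 2 2 1 3] 1223[of i j] sym(1)[of i j 1 2 2 3] by simp
  have 1233: "T i j (1,2,3,3) = 0" for i j
    using lower[OF 1133, of 1 i j 2] sym(1)[of i j 1 2 3 3] by simp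
  have 2233: "T i j (2,2,3,3) = 0" for i j
    using lower[OF 1233, of 1 i j 2] by simp
  have 3312: "T i j (3,3,1,2) = 0" for i j
    using schur22_pair_symmetry[OF s22, of i j 3 3 1 2] 1233 by simp
  have "T i j k = 0" for i j k
    by (rule determined_by_zero_coords[OF schur22_determined s22])
      (auto simp: coords22_def top 1123 1133 2213 2233 3312)
  then show ?thesis by (simp add: fun_eq_iff)
qed

section \<open>Proportionality of invariant tensors\<close>

lemma pieri_tensor_highest: "pieri_tensor 1 (2,2,1) (1,1,2,2) = 16"
  by (simp add: pieri_tensor_def identity_tensor_def young22_def row22_def col22_def young21_def)

lemma young21_diff_scaled: "young21 (\<lambda>j. x j - c * y j) j = young21 x j - c * young21 y j"
  by (cases j) (simp add: young21_def algebra_simps)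

lemma young22_diff_scaled: "young22 (\<lambda>k. x k - c * y k) k = young22 x k - c * young22 y k"
  by (cases k) (simp add: young22_def row22_def col22_def algebra_simps)

lemma in_schur_space_diff_scaled:
  assumes "in_schur_space T" "in_schur_space T'"
  shows "in_schur_space (\<lambda>i j k. T' i j k - c * T i j k)"
proof -
  obtain S S' where S: "T = (\<lambda>i j k. young22 (\<lambda>k'. young21 (\<lambda>j'. S i j' k') j) k)"
    "T' = (\<lambda>i j k. young22 (\<lambda>k'. young21 (\<lambda>j'. S' i j' k') j) k)"
    using assms unfolding in_schur_space_def by auto
  have "(\<lambda>i j k. T' i j k - c * T i j k)
      = (\<lambda>i j k. young22 (\<lambda>k'. young21 (\<lambda>j'. S' i j' k' - c * S i j' k') j) k)"
    by (intro ext) (simp only: S young21_diff_scaled young22_diff_scaled)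
  then show ?thesis
    unfolding in_schur_space_def by (intro exI[of _ "\<lambda>i j k. S' i j k - c * S i j k"])
qed

lemma gl3_invariant_diff_scaled:
  assumes "gl3_invariant T" "gl3_invariant T'"
  shows "gl3_invariant (\<lambda>i j k. T' i j k - c * T i j k)"
  unfolding gl3_invariant_def
proof (intro allI impI)
  fix g :: "complex^3^3" assume "invertible g"
  then have "gl3_act g T = T" "gl3_act g T' = T'" using assms by (auto simp: gl3_invariant_def)
  moreover have "gl3_act g (\<lambda>i j k. T' i j k - c * T i j k) = (\<lambda>i j k. gl3_act g T' i j k - c * gl3_act g T i j k)"
    by (simp add: fun_eq_iff gl3_act_def Let_def sum_distrib_left right_diff_distrib sum_subtractf mult_ac)
  ultimately show "gl3_act g (\<lambda>i j k. T' i j k - c * T i j k) = (\<lambda>i j k. T' i j k - c * T i j k)" by simp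
qed

lemma invariant_unique:
  assumes T: "in_schur_space T" "gl3_invariant T" "T \<noteq> (\<lambda>_ _ _. 0)"
    and T': "in_schur_space T'" "gl3_invariant T'"
  shows "\<exists>c. T' = (\<lambda>i j k. c * T i j k)"
proof -
  have nz: "T 1 (2,2,1) (1,1,2,2) \<noteq> 0"
    using invariant_zero_if_highest_coordinate_zero[OF T(1,2)] T(3) by blast
  define c where "c = T' 1 (2,2,1) (1,1,2,2) / T 1 (2,2,1) (1,1,2,2)"
  have "(\<lambda>i j k. T' i j k - c * T i j k) = (\<lambda>_ _ _. 0)"
    using nz by (intro invariant_zero_if_highest_coordinate_zero in_schur_space_diff_scaled
        gl3_invariant_diff_scaled T T') (simp add: c_def)
  then have "T' = (\<lambda>i j k. c * T i j k)" by (simp add: fun_eq_iff)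
  then show ?thesis by blast
qed

lemma pieri_tensor_nonzero: "pieri_tensor \<noteq> (\<lambda>_ _ _. 0)"
proof
  assume "pieri_tensor = (\<lambda>_ _ _. 0)"
  then have "pieri_tensor 1 (2,2,1) (1,1,2,2) = 0" by (rule fun_cong[OF fun_cong[OF fun_cong]])
  then show False by (simp add: pieri_tensor_highest)
qed

text \<open>The slices of the tensor in coordinates. For weight reasons each involves at most one
  coordinate of \<open>f\<close>, except in the two-dimensional weight space spanned by (1,2,3) and
  (2,3,1).\<close>

lemma sum_pieri_tensor:
  fixes f :: "3 \<times> 3 \<times> 3 \<Rightarrow> complex"
  shows
    "(\<Sum>y\<in>coords21. f y * pieri_tensor 1 y (1,1,2,2)) = 16 * f (2,2,1)"
    "(\<Sum>y\<in>coords21. f y * pieri_tensor 2 y (1,1,2,2)) = 16 * f (1,1,2)"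
    "(\<Sum>y\<in>coords21. f y * pieri_tensor 3 y (1,1,2,2)) = 0"
    "(\<Sum>y\<in>coords21. f y * pieri_tensor 1 y (1,1,3,3)) = 16 * f (3,3,1)"
    "(\<Sum>y\<in>coords21. f y * pieri_tensor 2 y (1,1,3,3)) = 0"
    "(\<Sum>y\<in>coords21. f y * pieri_tensor 3 y (1,1,3,3)) = 16 * f (1,1,3)"
    "(\<Sum>y\<in>coords21. f y * pieri_tensor 1 y (2,2,3,3)) = 0"
    "(\<Sum>y\<in>coords21. f y * pieri_tensor 2 y (2,2,3,3)) = 16 * f (3,3,2)"
    "(\<Sum>y\<in>coords21. f y * pieri_tensor 3 y (2,2,3,3)) = 16 * f (2,2,3)"
    "(\<Sum>y\<in>coords21. f y * pieri_tensor 1 y (1,1,2,3)) = -4 * f (1,2,3) + 8 * f (2,3,1)"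
    "(\<Sum>y\<in>coords21. f y * pieri_tensor 2 y (1,1,2,3)) = 8 * f (1,1,3)"
    "(\<Sum>y\<in>coords21. f y * pieri_tensor 3 y (1,1,2,3)) = 8 * f (1,1,2)"
    "(\<Sum>y\<in>coords21. f y * pieri_tensor 1 y (2,2,1,3)) = 8 * f (2,2,3)"
    "(\<Sum>y\<in>coords21. f y * pieri_tensor 2 y (2,2,1,3)) = -4 * f (1,2,3) + -4 * f (2,3,1)"
    "(\<Sum>y\<in>coords21. f y * pieri_tensor 3 y (2,2,1,3)) = 8 * f (2,2,1)"
    "(\<Sum>y\<in>coords21. f y * pieri_tensor 1 y (3,3,1,2)) = 8 * f (3,3,2)"
    "(\<Sum>y\<in>coords21. f y * pieri_tensor 2 y (3,3,1,2)) = 8 * f (3,3,1)"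
    "(\<Sum>y\<in>coords21. f y * pieri_tensor 3 y (3,3,1,2)) = 8 * f (1,2,3) + -4 * f (2,3,1)"
  by (simp_all add: coords21_def pieri_tensor_def identity_tensor_def young22_def row22_def col22_def young21_def)

text \<open>Injectivity of the Young flattening at the invariant tensor, in 6 * 8 unknowns: the
  condition under which \<open>not_border_rank_le_nine\<close> applies.\<close>

lemma pieri_tensor_symmetric_contraction:
  fixes s :: "3 \<Rightarrow> 3 \<Rightarrow> 3 \<times> 3 \<times> 3 \<Rightarrow> complex"
  assumes sym: "\<And>a b y. s a b y = s b a y"
    and eq: "\<And>a b c k. k \<in> coords22 \<Longrightarrow>
      (\<Sum>y\<in>coords21. s a b y * pieri_tensor c y k) = (\<Sum>y\<in>coords21. s a c y * pieri_tensor b y k)"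
    and "y \<in> coords21"
  shows "s a b y = 0"
proof -
  note e = eq[of "(1,1,2,2)", simplified coords22_def, simplified] eq[of "(1,1,3,3)", simplified coords22_def, simplified]
    eq[of "(2,2,3,3)", simplified coords22_def, simplified] eq[of "(1,1,2,3)", simplified coords22_def, simplified]
    eq[of "(2,2,1,3)", simplified coords22_def, simplified] eq[of "(3,3,1,2)", simplified coords22_def, simplified]
  have zero: "s a 3 (2,2,1) = 0" "s a 3 (1,1,2) = 0" "s a 2 (3,3,1) = 0" "s a 2 (1,1,3) = 0"
    "s a 1 (3,3,2) = 0" "s a 1 (2,2,3) = 0" for a
    using e(1)[of a 1 3] e(1)[of a 2 3] e(2)[of a 1 2] e(2)[of a 2 3] e(3)[of a 1 2] e(3)[of a 1 3]
    by (simp_all add: sum_pieri_tensor)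
  have swap: "s a 1 (1,1,2) = s a 2 (2,2,1)" "s a 1 (1,1,3) = s a 3 (3,3,1)" "s a 2 (2,2,3) = s a 3 (3,3,2)"
    "s a 2 (1,1,2) = s a 3 (1,1,3)" "s a 1 (2,2,1) = s a 3 (2,2,3)" "s a 1 (3,3,1) = s a 2 (3,3,2)" for a
    using e(1)[of a 1 2] e(2)[of a 1 3] e(3)[of a 2 3] e(4)[of a 2 3] e(5)[of a 1 3] e(6)[of a 1 2]
    by (simp_all add: sum_pieri_tensor)
  have mixed1: "s a 1 (1,2,3) = 0 \<and> s a 1 (2,3,1) = -2 * s a 2 (2,2,3)" for a
  proof -
    have "-4 * s a 1 (1,2,3) + -4 * s a 1 (2,3,1) = 8 * s a 2 (2,2,3)"
      "8 * s a 1 (1,2,3) + -4 * s a 1 (2,3,1) = 8 * s a 2 (2,2,3)"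
      using e(5)[of a 1 2] e(6)[of a 1 3] swap(3)[of a] by (simp_all add: sum_pieri_tensor)
    then have "12 * s a 1 (1,2,3) = 0" "4 * s a 1 (2,3,1) = 4 * (-2 * s a 2 (2,2,3) - s a 1 (1,2,3))" by algebra+
    then show ?thesis unfolding mult_cancel_left by simp
  qed
  have mixed2: "s a 2 (1,2,3) = 2 * s a 1 (1,1,3) \<and> s a 2 (2,3,1) = 2 * s a 1 (1,1,3)" for a
  proof -
    have "-4 * s a 2 (1,2,3) + 8 * s a 2 (2,3,1) = 8 * s a 1 (1,1,3)"
      "8 * s a 2 (1,2,3) + -4 * s a 2 (2,3,1) = 8 * s a 1 (1,1,3)"
      using e(4)[of a 1 2] e(6)[of a 2 3] swap(2)[of a] by (simp_all add: sum_pieri_tensor)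
    then have "12 * s a 2 (1,2,3) = 12 * (2 * s a 1 (1,1,3))" "12 * s a 2 (2,3,1) = 12 * (2 * s a 1 (1,1,3))" by algebra+
    then show ?thesis unfolding mult_cancel_left by simp
  qed
  have mixed3: "s a 3 (2,3,1) = 0 \<and> s a 3 (1,2,3) = -2 * s a 1 (1,1,2)" for a
  proof -
    have "-4 * s a 3 (1,2,3) + 8 * s a 3 (2,3,1) = 8 * s a 1 (1,1,2)"
      "-4 * s a 3 (1,2,3) + -4 * s a 3 (2,3,1) = 8 * s a 1 (1,1,2)"
      using e(4)[of a 1 3] e(5)[of a 2 3] swap(1)[of a] by (simp_all add: sum_pieri_tensor)
    then have "12 * s a 3 (2,3,1) = 0" "4 * s a 3 (1,2,3) = 4 * (-2 * s a 1 (1,1,2) - s a 3 (2,3,1))" by algebra+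
    then show ?thesis unfolding mult_cancel_left by simp
  qed
  \<comment> \<open>So far \<open>a\<close> was a parameter and only the exchange of the second and
    third tensor indices was used. Now the symmetry of \<open>s\<close> enters, with every
    \<open>s a b\<close> written with the smaller index first.\<close>
  note sorted = sym[of 2 1] sym[of 3 1] sym[of 3 2]
  note swap' = swap[of 1, unfolded sorted] swap[of 2, unfolded sorted] swap[of 3, unfolded sorted]
  note zero' = zero[of 1, unfolded sorted] zero[of 2, unfolded sorted] zero[of 3, unfolded sorted]
  note mixed = mixed1[of 1, unfolded sorted] mixed1[of 2, unfolded sorted] mixed1[of 3, unfolded sorted]
    mixed2[of 1, unfolded sorted] mixed2[of 2, unfolded sorted] mixed2[of 3, unfolded sorted]
    mixed3[of 1, unfolded sorted] mixed3[of 2, unfolded sorted] mixed3[of 3, unfolded sorted]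
  \<comment> \<open>In each case a coordinate (1,2,3) or (2,3,1) of some \<open>s a b\<close> with
    distinct \<open>a\<close>, \<open>b\<close> is evaluated twice, once with either index as the
    parameter.\<close>
  have A: "s 1 3 (1,1,3) = 0" using mixed(6,8) by simp
  have B: "s 2 3 (2,2,3) = 0" using mixed(3,7) by simp
  have C: "s 1 1 (1,1,3) = 0" using mixed(2,4) by simp
  have A': "s 1 2 (1,1,2) = 0" "s 2 2 (2,2,1) = 0" "s 3 3 (3,3,1) = 0"
    using A swap'(4,7,14) by simp_all
  have B': "s 1 1 (1,1,2) = 0" "s 1 2 (2,2,1) = 0" "s 3 3 (3,3,2) = 0"
    using B swap'(1,11,15) by simp_all
  have C': "s 1 3 (3,3,1) = 0" "s 2 3 (3,3,2) = 0" "s 2 2 (2,2,3) = 0"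
    using C swap'(2,9,18) by simp_all
  have D: "s 2 2 (1,1,2) = 0" "s 3 3 (1,1,3) = 0" "s 1 1 (2,2,1) = 0" "s 3 3 (2,2,3) = 0"
    "s 1 1 (3,3,1) = 0" "s 2 2 (3,3,2) = 0"
    using swap'(10) zero'(16) swap'(16) zero'(8) swap'(5) zero'(18) swap'(17) zero'(1)
      swap'(6) zero'(11) swap'(12) zero'(3)
    by (simp_all only:)
  have "\<forall>a b. s a b y = 0" if "y \<in> coords21" for y
    using that unfolding coords21_def insert_iff empty_iff forall_3
    by (elim disjE) (simp_all add: sorted zero' A B C A' B' C' D mixed)
  then show ?thesis using assms(3) by blast
qed

text \<open>\<open>R\<close> is \<open>T\<close> in format 3 x 8 x 6. The lower bound passes to
  \<open>T\<close> because \<open>R\<close> selects entries of \<open>T\<close>, the upper bound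
  because \<open>T\<close> is a linear image of \<open>R\<close>. At the same time \<open>R\<close>
  shows that 10 is attained in the small format.\<close>

lemma border_rank_pieri:
  assumes "in_schur_space T" "gl3_invariant T" "T \<noteq> (\<lambda>_ _ _. 0)"
  shows "border_rank T = 10" and "\<exists>T' :: 3 \<Rightarrow> 8 \<Rightarrow> 6 \<Rightarrow> complex. border_rank T' = 10"
proof -
  obtain c where c: "T = (\<lambda>i j k. c * pieri_tensor i j k)"
    using invariant_unique[OF in_schur_space_pieri_tensor gl3_invariant_pieri_tensor pieri_tensor_nonzero] assms by blast
  then have c0: "c \<noteq> 0" using assms(3) by auto
  obtain J :: "8 \<Rightarrow> 3 \<times> 3 \<times> 3" where J: "bij_betw J UNIV coords21"
    using finite_same_card_bij[of "UNIV :: 8 set" coords21] by (auto simp: card_coords)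
  obtain K :: "6 \<Rightarrow> 3 \<times> 3 \<times> 3 \<times> 3" where K: "bij_betw K UNIV coords22"
    using finite_same_card_bij[of "UNIV :: 6 set" coords22] by (auto simp: card_coords)
  define R where "R i x y = T i (J x) (K y)" for i x y
  have lower: "\<not> border_rank_le 9 R"
  proof (rule not_border_rank_le_nine)
    show "CARD(8) = 8" by simp
    fix s :: "3 \<Rightarrow> 3 \<Rightarrow> 8 \<Rightarrow> complex"
    assume sym: "\<And>a b x. s a b x = s b a x"
      and eq: "\<And>a b c k. (\<Sum>x\<in>UNIV. s a b x * R c x k) = (\<Sum>x\<in>UNIV. s a c x * R b x k)"
    define \<sigma> where "\<sigma> a b y = s a b (inv_into UNIV J y)" for a b y
    have \<sigma>: "\<sigma> a b (J x) = s a b x" for a b x using J by (simp add: \<sigma>_def bij_betw_def)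
    have "\<sigma> a b y = 0" if y: "y \<in> coords21" for a b y
    proof (rule pieri_tensor_symmetric_contraction[OF _ _ y])
      show "\<sigma> a b y = \<sigma> b a y" for a b y by (simp add: \<sigma>_def sym[of a b])
      fix a b d k assume "k \<in> coords22"
      then obtain k' where k': "k = K k'" using K by (auto simp: bij_betw_def)
      have "(\<Sum>x\<in>UNIV. s a b x * R d x k') = c * (\<Sum>y\<in>coords21. \<sigma> a b y * pieri_tensor d y k)" for a b d
        unfolding sum.reindex_bij_betw[OF J, symmetric] sum_distrib_left
        by (simp add: \<sigma> R_def c k' mult_ac)
      then show "(\<Sum>y\<in>coords21. \<sigma> a b y * pieri_tensor d y k) = (\<Sum>y\<in>coords21. \<sigma> a d y * pieri_tensor b y k)"
        using eq[of a b d k'] c0 by simp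
    qed
    moreover have "J x \<in> coords21" for x using J by (auto simp: bij_betw_def)
    ultimately have "s a b x = 0" for a b x using \<sigma>[of a b x] by metis
    then show "s = (\<lambda>_ _ _. 0)" by (simp add: fun_eq_iff)
  qed
  have "border_rank R = Suc 9"
    using border_rank_le_ten[of R] lower by (intro border_rank_eqI) simp_all
  then show "\<exists>T' :: 3 \<Rightarrow> 8 \<Rightarrow> 6 \<Rightarrow> complex. border_rank T' = 10" by auto
  have "\<not> border_rank_le 9 T"
    using lower border_rank_le_reindex[of 9 T J K] by (auto simp: R_def[abs_def])
  moreover have "border_rank_le (Suc 9) T"
  proof -
    have "\<forall>j. \<exists>q. \<forall>z. schur21 z \<longrightarrow> z j = (\<Sum>y\<in>coords21. q y * z y)"
      using schur21_determined unfolding determined_by_def by blast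
    then obtain P where P: "\<And>j z. schur21 z \<Longrightarrow> z j = (\<Sum>y\<in>coords21. P j y * z y)" by metis
    have "\<forall>k. \<exists>q. \<forall>z. schur22 z \<longrightarrow> z k = (\<Sum>y\<in>coords22. q y * z y)"
      using schur22_determined unfolding determined_by_def by blast
    then obtain Q where Q: "\<And>k z. schur22 z \<Longrightarrow> z k = (\<Sum>y\<in>coords22. Q k y * z y)" by metis
    have "T i j k = (\<Sum>x\<in>UNIV. \<Sum>y\<in>UNIV. P j (J x) * Q k (K y) * R i x y)" for i j k
    proof -
      have "T i j k = (\<Sum>x\<in>UNIV. P j (J x) * T i (J x) k)"
        using P[where z = "\<lambda>j. T i j k" and j = j] in_schur_space_schur21[OF assms(1), of i k]
        by (simp add: sum.reindex_bij_betw[OF J, symmetric])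
      also have "\<dots> = (\<Sum>x\<in>UNIV. P j (J x) * (\<Sum>y\<in>UNIV. Q k (K y) * T i (J x) (K y)))"
        using Q[OF in_schur_space_schur22[OF assms(1)], where k = k]
        by (simp add: sum.reindex_bij_betw[OF K, symmetric])
      finally show ?thesis by (simp add: R_def sum_distrib_left mult.assoc)
    qed
    then have T_eq: "T = (\<lambda>i j k. \<Sum>x\<in>UNIV. \<Sum>y\<in>UNIV. P j (J x) * Q k (K y) * R i x y)"
      by (simp add: fun_eq_iff)
    have "border_rank_le (Suc 9) R" using border_rank_le_ten[of R] by simp
    then show ?thesis by (subst T_eq) (rule border_rank_le_transform)
  qed
  ultimately have "border_rank T = Suc 9" by (intro border_rank_eqI)
  then show "border_rank T = 10" by simp
qed

theorem theorem3:
  shows "(\<exists>T. in_schur_space T \<and> gl3_invariant T \<and> T \<noteq> (\<lambda>_ _ _. 0))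
       \<and> (\<forall>T T'. in_schur_space T \<and> gl3_invariant T \<and> T \<noteq> (\<lambda>_ _ _. 0)
              \<and> in_schur_space T' \<and> gl3_invariant T' \<longrightarrow> (\<exists>c. T' = (\<lambda>i j k. c * T i j k)))
       \<and> (\<forall>T. in_schur_space T \<and> gl3_invariant T \<and> T \<noteq> (\<lambda>_ _ _. 0) \<longrightarrow> border_rank T = 10)
       \<and> (\<forall>T :: 3 \<Rightarrow> 8 \<Rightarrow> 6 \<Rightarrow> complex. border_rank T \<le> 10)
       \<and> (\<exists>T :: 3 \<Rightarrow> 8 \<Rightarrow> 6 \<Rightarrow> complex. border_rank T = 10)"
proof (intro conjI allI impI)
  note pieri = in_schur_space_pieri_tensor gl3_invariant_pieri_tensor pieri_tensor_nonzero
  show "\<exists>T. in_schur_space T \<and> gl3_invariant T \<and> T \<noteq> (\<lambda>_ _ _. 0)" using pieri by blast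
  show "\<exists>T :: 3 \<Rightarrow> 8 \<Rightarrow> 6 \<Rightarrow> complex. border_rank T = 10" using border_rank_pieri(2)[OF pieri] .
  show "border_rank T \<le> 10" for T :: "3 \<Rightarrow> 8 \<Rightarrow> 6 \<Rightarrow> complex"
    unfolding border_rank_def using border_rank_le_ten by (rule Least_le)
  fix T T' :: amb_tensor
  show "\<exists>c. T' = (\<lambda>i j k. c * T i j k)"
    if "in_schur_space T \<and> gl3_invariant T \<and> T \<noteq> (\<lambda>_ _ _. 0) \<and> in_schur_space T' \<and> gl3_invariant T'"
    using invariant_unique[of T T'] that by simp
  show "border_rank T = 10" if "in_schur_space T \<and> gl3_invariant T \<and> T \<noteq> (\<lambda>_ _ _. 0)"
    using border_rank_pieri(1)[of T] that by simp
qed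

end
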